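(* Let $\Phi$ denote the fine-grid time-stepping operator and $\Psi$ the coarse-grid time-stepping operator (invertible $N_x\times N_x$ matrices with $\|\Phi^q\|,\|\Psi^q\|<1$ for some $q$), with coarsening factor $k$, and $N_c$ coarse-grid time points. Assume that $\Phi$ and $\Psi$ commute and are diagonalizable, with eigenvectors as columns of $U$ and corresponding eigenvalues $\lambda_i$ of $\Phi$ and $\mu_i$ of $\Psi$. Then $$\sup_i\frac{|\mu_i-\lambda_i^k|}{\sqrt{(1-|\mu_i|)^2+\frac{\pi^2|\mu_i|}{N_c^2}}}\le\|I-A_\Delta B_\Delta^{-1}\|_{(UU^* )^{-1}}\le\sup_i\frac{|\mu_i-\lambda_i^k|}{\sqrt{(1-|\mu_i|)^2+\frac{\pi^2|\mu_i|}{6N_c^2}}},$$ $$\sup_i\frac{|\lambda_i^k||\mu_i-\lambda_i^k|}{\sqrt{(1-|\mu_i|)^2+\frac{\pi^2|\mu_i|}{N_c^2}}}\le\left\|(I-A_\Delta B_\Delta^{-1})A_{cf}A_{ff}^{-1}A_{fc}\right\|_{(UU^* )^{-1}}\le\sup_i\frac{|\lambda_i^k||\mu_i-\lambda_i^k|}{\sqrt{(1-|\mu_i|)^2+\frac{\pi^2|\mu_i|}{6N_c^2}}}.$$ Furthermore, for $p\ge1$, $$\left\|(I-A_\Delta B_\Delta^{-1})^p\right\|_{(UU^* )^{-1}}=\sup_i\frac{|\mu_i-\lambda_i^k|^p}{\sqrt{(1-|\mu_i|)^{2p}+O(1/N_c^2)}},$$ $$\left\|\left((I-A_\Delta B_\Delta^{-1})A_{cf}A_{ff}^{-1}A_{fc}\right)^p\right\|_{(UU^*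 )^{-1}}=\sup_i\frac{|\lambda_i^k|^p|\mu_i-\lambda_i^k|^p}{\sqrt{(1-|\mu_i|)^{2p}+O(1/N_c^2)}}.$$
   Context: All matrices below are $N_c\times N_c$ block matrices with blocks of size $N_x\times N_x$. $A_\Delta$ and $B_\Delta$ have identity blocks on the diagonal and zeros elsewhere except on the first block subdiagonal, where $A_\Delta$ has $-\Phi^k$ and $B_\Delta$ has $-\Psi$. The matrix $A_{cf}A_{ff}^{-1}A_{fc}$ has $\Phi^k$ on the first block subdiagonal and zeros elsewhere. (It arises by partitioning the $N=(N_c-1)k+1$ time points into C-points, the multiples of $k$, and F-points, the others, in the block bidiagonal space-time matrix $A$ with identity diagonal blocks and $-\Phi$ on the first block subdiagonal: with F-points ordered first, $A=\begin{bmatrix} A_{ff} & A_{fc} \\ A_{cf} & A_{cc} \end{bmatrix}$, $A_{cc}=I$, and $A_\Delta=A_{cc}-A_{cf}A_{ff}^{-1}A_{fc}$.) The two operators correspond to Parareal / two-level MGRiT with F-relaxation and to two-level MGRiT with FCF-relaxation, respectively. For a block vector $\mathbf{x}$ with blocks $\mathbf{x}_j\in\mathbb{C}^{N_x}$, $\|\mathbf{x}\|_{(UU^* )^{-1}}^2=\sum_j\|U^{-1}\mathbf{x}_j\|^2$ with $\|\cdot\|$ Euclidean, and the induced operator norm is used on block matrices. Convention: $O(1/N_c^2)$ denotes a positive term of that order as $N_c$ grows, $\Phi$ and $\Psi$ being independent of $N_c$.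
   Formalization: The FCF lower bound is false as printed (N_x=1, N_c=3, k=2, Φ=1/2, Ψ=1/10); proved with N_c−1 for N_c≥3, and as printed for each i with 2|μ_i|cos(π/N_c)≥1. All bounds take N_c≥2; the p-th power identities take N_c>p (F) and N_c>2p (FCF). *)

theory Defs
  imports
    "HOL-Library.Landau_Symbols"
    "Jordan_Normal_Form.Char_Poly"
    "Jordan_Normal_Form.Gauss_Jordan_Elimination"
begin

(* Only meaningful for invertible A; mat_inverse returns None otherwise. *)
abbreviation mat_inv :: "complex mat \<Rightarrow> complex mat" where
  "mat_inv A \<equiv> the (mat_inverse A)"

definition l2_norm :: "complex vec \<Rightarrow> real" where
  "l2_norm v = sqrt (\<Sum>i<dim_vec v. (cmod (v $ i))\<^sup>2)"

definition induced_norm :: "(complex vec \<Rightarrow> real) \<Rightarrow> complex mat \<Rightarrow> real" where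
  "induced_norm nrm A =
     Sup {nrm (A *\<^sub>v v) / nrm v | v. v \<in> carrier_vec (dim_col A) \<and> v \<noteq> 0\<^sub>v (dim_col A)}"

(* Nc x Nc blocks, each of size Nx x Nx: D on the block diagonal, S on the first
   block subdiagonal, zero blocks elsewhere. *)
definition block_bidiag :: "nat \<Rightarrow> nat \<Rightarrow> complex mat \<Rightarrow> complex mat \<Rightarrow> complex mat" where
  "block_bidiag Nx Nc D S = mat (Nc * Nx) (Nc * Nx) (\<lambda>(a, b).
     if a div Nx = b div Nx then D $$ (a mod Nx, b mod Nx)
     else if a div Nx = Suc (b div Nx) then S $$ (a mod Nx, b mod Nx)
     else 0)"

definition A_Delta :: "nat \<Rightarrow> nat \<Rightarrow> nat \<Rightarrow> complex mat \<Rightarrow> complex mat" where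
  "A_Delta Nx Nc k \<Phi> = block_bidiag Nx Nc (1\<^sub>m Nx) (- (\<Phi> ^\<^sub>m k))"

definition B_Delta :: "nat \<Rightarrow> nat \<Rightarrow> complex mat \<Rightarrow> complex mat" where
  "B_Delta Nx Nc \<Psi> = block_bidiag Nx Nc (1\<^sub>m Nx) (- \<Psi>)"

(* The matrix A_cf A_ff^{-1} A_fc of the space-time system. *)
definition A_cf_ff_fc :: "nat \<Rightarrow> nat \<Rightarrow> nat \<Rightarrow> complex mat \<Rightarrow> complex mat" where
  "A_cf_ff_fc Nx Nc k \<Phi> = block_bidiag Nx Nc (0\<^sub>m Nx Nx) (\<Phi> ^\<^sub>m k)"

definition block :: "nat \<Rightarrow> complex vec \<Rightarrow> nat \<Rightarrow> complex vec" where
  "block Nx x j = vec Nx (\<lambda>i. x $ (j * Nx + i))"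

definition U_vec_norm :: "nat \<Rightarrow> nat \<Rightarrow> complex mat \<Rightarrow> complex vec \<Rightarrow> real" where
  "U_vec_norm Nx Nc U x = sqrt (\<Sum>j<Nc. (l2_norm (mat_inv U *\<^sub>v block Nx x j))\<^sup>2)"

(* The operator norm on block matrices induced by the (U U^* )^{-1}-norm. *)
definition U_norm :: "nat \<Rightarrow> nat \<Rightarrow> complex mat \<Rightarrow> complex mat \<Rightarrow> real" where
  "U_norm Nx Nc U = induced_norm (U_vec_norm Nx Nc U)"

(* I - A_Delta B_Delta^{-1}: Parareal / two-level MGRiT with F-relaxation. *)
definition F_op :: "nat \<Rightarrow> nat \<Rightarrow> nat \<Rightarrow> complex mat \<Rightarrow> complex mat \<Rightarrow> complex mat" where
  "F_op Nx Nc k \<Phi> \<Psi> = 1\<^sub>m (Nc * Nx) - A_Delta Nx Nc k \<Phi> * mat_inv (B_Delta Nx Nc \<Psi>)"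

(* (I - A_Delta B_Delta^{-1}) A_cf A_ff^{-1} A_fc: two-level MGRiT with FCF-relaxation.
   Its blocks vanish up to and including the first subdiagonal, so it has effectively Nc - 2
   nontrivial block rows: one fewer than F_op.  This is why a lower bound valid for all
   eigenvalues involves pi / (Nc - 1) rather than pi / Nc: the latter fails, for instance, for
   Nx = 1, Nc = 3, k = 2, Phi = 1/2, Psi = 1/10. *)
definition FCF_op :: "nat \<Rightarrow> nat \<Rightarrow> nat \<Rightarrow> complex mat \<Rightarrow> complex mat \<Rightarrow> complex mat" where
  "FCF_op Nx Nc k \<Phi> \<Psi> = F_op Nx Nc k \<Phi> \<Psi> * A_cf_ff_fc Nx Nc k \<Phi>"

end

theory Submission
  imports Defs "HOL-Computational_Algebra.Formal_Power_Series" "HOL-Analysis.L2_Norm"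
begin

text \<open>In the eigenvector basis both operators decouple into \<open>Nx\<close> scalar lower triangular Toeplitz
  matrices, that is, into truncated multiplications by the power series
  \<open>(lam ^ k - mu) X / (1 - mu X)\<close> and \<open>lam ^ k (lam ^ k - mu) X\<^sup>2 / (1 - mu X)\<close>, and the norm is the
  largest of the scalar norms. The factor \<open>X ^ m\<close> only removes \<open>m\<close> rows, so everything
  reduces to the least singular value of \<open>(1 - mu X) ^ p\<close> on \<open>n = Nc - m\<close> coefficients. With
  \<open>r = \<bar>mu\<bar>\<close>, the identity
  \<open>\<bar>a - r b\<bar>\<^sup>2 = (1 - r) \<bar>a\<bar>\<^sup>2 - r (1 - r) \<bar>b\<bar>\<^sup>2 + r \<bar>a - b\<bar>\<^sup>2\<close>
  separates \<open>(1 - r)\<^sup>2\<close> from a multiple of the energy of differences. A discrete Poincare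
  inequality and \<open>pi\<^sup>2 \<le> 12\<close> bound the latter from below; the sine vector
  \<open>sin (j pi / (n + 1))\<close>, rotated by the phase of \<open>mu\<close>, bounds it from above.\<close>

section \<open>Numerical bounds for pi and the cosine\<close>

text \<open>At sqrt 3 the Taylor polynomial of the cosine is 1 - 3/2 + 9/24 = -1/8, and the
  remainder of order six is at most 27/720. So the cosine is negative there, which forces pi/2 \<le>
  sqrt 3.\<close>

lemma pi_squared_le_12: "pi\<^sup>2 \<le> 12"
proof -
  define x where "x = sqrt (3::real)"
  have x: "x > 0" "x ^ 2 = 3" by (auto simp: x_def)
  obtain t where t: "cos x = (\<Sum>m<6. cos_coeff m * x ^ m) + (cos (t + 1/2 * real (6::nat) * pi) / fact 6) * x ^ 6"
    using Maclaurin_cos_expansion2[of x 6] x by auto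
  have p: "x ^ 4 = 9" "x ^ 6 = 27"
    using power_mult[of x 2 2] power_mult[of x 2 3] x by auto
  have "cos (t + 1/2 * real (6::nat) * pi) / fact 6 * x ^ 6 \<le> 1 / fact 6 * 27"
    unfolding p by (intro mult_right_mono divide_right_mono) auto
  moreover have "(\<Sum>m<6. cos_coeff m * x ^ m) = 1 - x^2/2 + x^4/24"
  proof -
    have "{..<6::nat} = {0, 1, 2, 3, 4, 5}" by auto
    then show ?thesis by (simp add: cos_coeff_def fact_numeral)
  qed
  moreover have "3 * cos (t + 3 * pi) < 10" using cos_le_one[of "t + 3 * pi"] by linarith
  ultimately have "cos x < 0" using t x p by (simp add: fact_numeral)
  have "pi / 2 \<le> x"
  proof (rule ccontr)
    assume "\<not> pi / 2 \<le> x"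
    then have "cos x > 0" using x by (intro cos_gt_zero) auto
    with \<open>cos x < 0\<close> show False by simp
  qed
  then have "pi \<le> 2 * x" by simp
  then have "pi\<^sup>2 \<le> (2 * x)\<^sup>2" by (rule power_mono) simp
  then show ?thesis using x by (simp add: power_mult_distrib)
qed

text \<open>Replaces the exact eigenvalue 2 (1 - cos t) of the sine vectors by t^2, which gives the
  lower norm bounds their pi^2.\<close>

lemma one_minus_cos_le: "1 - cos x \<le> x\<^sup>2 / 2" for x :: real
proof -
  have "1 - cos x = 2 * (sin (x / 2))\<^sup>2"
    using cos_double_sin[of "x / 2"] by simp
  also have "\<dots> \<le> 2 * (x / 2)\<^sup>2"
    using abs_sin_x_le_abs_x[of "x / 2"] by (simp only: mult_le_cancel_left_pos abs_le_square_iff)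
  finally show ?thesis by (simp add: power2_eq_square)
qed

section \<open>Lower triangular Toeplitz matrices as power series\<close>

text \<open>A vector of length N is represented by any power series with the same first N
  coefficients. In a product later coefficients never influence earlier ones, so lower triangular
  Toeplitz matrices become multiplications, and their powers and inverses are those of the
  series.\<close>

definition energy :: "nat \<Rightarrow> complex fps \<Rightarrow> real" where
  "energy N f = (\<Sum>j<N. (cmod (fps_nth f j))\<^sup>2)"

abbreviation bidiag :: "complex \<Rightarrow> complex fps" where
  "bidiag \<mu> \<equiv> 1 - fps_const \<mu> * fps_X"

lemma energy_nonneg [simp]: "energy N f \<ge> 0"
  by (simp add: energy_def sum_nonneg)

lemma energy_mono: "M \<le> N \<Longrightarrow> energy M f \<le> energy N f"
  unfolding energy_def by (intro sum_mono2) auto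

lemma energy_cong: "(\<And>j. j < N \<Longrightarrow> fps_nth f j = fps_nth g j) \<Longrightarrow> energy N f = energy N g"
  unfolding energy_def by (intro sum.cong) auto

lemma energy_const_mult: "energy N (fps_const c * f) = (cmod c)\<^sup>2 * energy N f"
  by (simp add: energy_def norm_mult power_mult_distrib sum_distrib_left)

text \<open>The shift pushes the last m of the N coefficients out of view; for m > N both sides are
  zero.\<close>

lemma energy_shift: "energy N (fps_X ^ m * f) = energy (N - m) f"
proof (cases "m \<le> N")
  case True
  have "energy N (fps_X ^ m * f) = (\<Sum>j\<in>{m..<N}. (cmod (fps_nth (fps_X ^ m * f) j))\<^sup>2)"
    unfolding energy_def by (intro sum.mono_neutral_right) (auto simp: fps_X_power_mult_nth)
  also have "\<dots> = energy (N - m) f"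
    unfolding energy_def
    by (rule sum.reindex_bij_witness[of _ "\<lambda>j. j + m" "\<lambda>j. j - m"]) (auto simp: fps_X_power_mult_nth)
  finally show ?thesis .
qed (auto simp: energy_def fps_X_power_mult_nth)

lemma energy_eqI_support:
  assumes "\<And>j. j \<ge> n \<Longrightarrow> fps_nth f j = 0" "n \<le> N"
  shows "energy N f = energy n f"
  unfolding energy_def using assms by (intro sum.mono_neutral_right) auto

lemma bidiag_mult_nth:
  "fps_nth (bidiag \<mu> * f) j = fps_nth f j - \<mu> * (if j = 0 then 0 else fps_nth f (j - 1))"
  by (simp add: algebra_simps)

lemma one_minus_X_mult_nth:
  "fps_nth ((1 - fps_X) * f) j = fps_nth f j - (if j = 0 then 0 else fps_nth f (j - 1))"
  for f :: "complex fps"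
  by (simp add: algebra_simps)

section \<open>Energy estimates for powers of 1 - mu X\<close>

lemma norm_diff_convex_identity:
  "(cmod (a - of_real r * b))\<^sup>2
    = (1 - r) * (cmod a)\<^sup>2 - r * (1 - r) * (cmod b)\<^sup>2 + r * (cmod (a - b))\<^sup>2"
  unfolding cmod_power2 by (simp add: power2_eq_square algebra_simps)

text \<open>Sums the convex identity with \<open>b\<close> the preceding coefficient. The shifted
  sequence loses its last coefficient, hence the energy over N - 1.\<close>

lemma energy_bidiag_real:
  "energy N (bidiag (of_real r) * f)
    = (1 - r) * energy N f - r * (1 - r) * energy (N - 1) f + r * energy N (bidiag 1 * f)"
proof -
  let ?b = "\<lambda>j. if j = 0 then 0 else fps_nth f (j - 1)"
  have "(\<Sum>j<N. (cmod (?b j))\<^sup>2) = energy N (fps_X ^ 1 * f)"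
    by (simp add: energy_def)
  then have b: "(\<Sum>j<N. (cmod (?b j))\<^sup>2) = energy (N - 1) f"
    by (simp only: energy_shift)
  have "energy N (bidiag (of_real r) * f)
      = (\<Sum>j<N. (1 - r) * (cmod (fps_nth f j))\<^sup>2 - r * (1 - r) * (cmod (?b j))\<^sup>2
           + r * (cmod (fps_nth (bidiag 1 * f) j))\<^sup>2)"
    unfolding energy_def bidiag_mult_nth norm_diff_convex_identity by simp
  also have "\<dots> = (1 - r) * energy N f - r * (1 - r) * (\<Sum>j<N. (cmod (?b j))\<^sup>2)
       + r * energy N (bidiag 1 * f)"
    by (simp only: sum.distrib sum_subtractf energy_def sum_distrib_left)
  finally show ?thesis unfolding b .
qed

text \<open>Discrete Poincare inequality. With the value zero before the start, f telescopes into
  its differences, and Cauchy-Schwarz bounds the square of coefficient j by j + 1 times their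
  energy.\<close>

lemma energy_le_difference:
  "energy N f \<le> real N * (real N + 1) / 2 * energy N (bidiag 1 * f)"
proof -
  let ?d = "\<lambda>j. fps_nth (bidiag 1 * f) j"
  have tel: "fps_nth f j = (\<Sum>l\<le>j. ?d l)" for j
    by (induction j) (auto simp: one_minus_X_mult_nth)
  have "(cmod (fps_nth f j))\<^sup>2 \<le> (real j + 1) * energy N (bidiag 1 * f)" if "j < N" for j
  proof -
    have "cmod (fps_nth f j) \<le> (\<Sum>l\<le>j. \<bar>1\<bar> * \<bar>cmod (?d l)\<bar>)"
      unfolding tel by (simp add: norm_sum)
    also have "\<dots> \<le> L2_set (\<lambda>_. 1) {..j} * L2_set (\<lambda>l. cmod (?d l)) {..j}"
      by (rule L2_set_mult_ineq)
    finally have "(cmod (fps_nth f j))\<^sup>2 \<le> (L2_set (\<lambda>_. 1) {..j} * L2_set (\<lambda>l. cmod (?d l)) {..j})\<^sup>2"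
      by (rule power_mono) simp
    also have "\<dots> = (real j + 1) * energy (Suc j) (bidiag 1 * f)"
      by (simp add: L2_set_def power_mult_distrib sum_nonneg energy_def lessThan_Suc_atMost add.commute)
    also have "\<dots> \<le> (real j + 1) * energy N (bidiag 1 * f)"
      using that by (intro mult_left_mono energy_mono) auto
    finally show ?thesis .
  qed
  then have "energy N f \<le> (\<Sum>j<N. (real j + 1) * energy N (bidiag 1 * f))"
    unfolding energy_def[of N f] by (intro sum_mono) auto
  also have "\<dots> = (\<Sum>j<N. real j + 1) * energy N (bidiag 1 * f)"
    by (simp add: sum_distrib_right)
  also have "(\<Sum>j<N. real j + 1) = real N * (real N + 1) / 2"
    by (induction N) (auto simp: field_simps)
  finally show ?thesis .
qed

text \<open>The Poincare constant N (N + 1) / 2 times pi^2 / (6 (N + 1)^2) is pi^2 N / (12 (N + 1)),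
  which is below 1 because pi^2 \<le> 12. So the difference term of the convex identity supplies the
  pi^2 term.\<close>

lemma energy_bidiag_ge:
  assumes "cmod \<mu> \<le> 1"
  shows "((1 - cmod \<mu>)\<^sup>2 + pi\<^sup>2 * cmod \<mu> / (6 * (real N + 1)\<^sup>2)) * energy N f
           \<le> energy N (bidiag \<mu> * f)"
proof -
  define r where "r = cmod \<mu>"
  \<comment> \<open>Moduli of the coefficients keep the energy of f and, by the reverse triangle
    inequality at the end, do not increase the energy after multiplication. This reduces
    \<open>\<mu>\<close> to its modulus.\<close>
  define y where "y = Abs_fps (\<lambda>j. complex_of_real (cmod (fps_nth f j)))"
  have r: "0 \<le> r" "r \<le> 1" using assms by (auto simp: r_def)
  have y: "energy M y = energy M f" for M by (simp add: energy_def y_def)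
  have rearr: "c / (6 * x\<^sup>2) * (n * x / 2 * e) = c * n / (12 * x) * e" if "x > 0" for c x n e :: real
    using that by (simp add: power2_eq_square field_simps)
  have "pi\<^sup>2 / (6 * (real N + 1)\<^sup>2) * energy N y \<le> energy N (bidiag 1 * y)"
  proof -
    have "pi\<^sup>2 / (6 * (real N + 1)\<^sup>2) * energy N y
        \<le> pi\<^sup>2 / (6 * (real N + 1)\<^sup>2) * (real N * (real N + 1) / 2 * energy N (bidiag 1 * y))"
      by (intro mult_left_mono energy_le_difference) auto
    also have "\<dots> = (pi\<^sup>2 * real N / (12 * (real N + 1))) * energy N (bidiag 1 * y)"
      using rearr[of "real N + 1" "pi\<^sup>2" "real N" "energy N (bidiag 1 * y)"] by simp
    also have "\<dots> \<le> 1 * energy N (bidiag 1 * y)"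
    proof (rule mult_right_mono)
      have "pi\<^sup>2 * real N \<le> 12 * (real N + 1)"
        using mult_right_mono[OF pi_squared_le_12, of "real N"] by simp
      then show "pi\<^sup>2 * real N / (12 * (real N + 1)) \<le> 1"
        by (simp add: pos_divide_le_eq)
    qed simp
    finally show ?thesis by simp
  qed
  from mult_left_mono[OF this r(1)]
  have 1: "pi\<^sup>2 * r / (6 * (real N + 1)\<^sup>2) * energy N y \<le> r * energy N (bidiag 1 * y)"
    by (simp add: mult_ac)
  \<comment> \<open>Enlarging the boundary energy to the full one leaves (1 - r) - r (1 - r) = (1 -
    r)^2 as the coefficient.\<close>
  have "r * (1 - r) * energy (N - 1) y \<le> r * (1 - r) * energy N y"
    using r by (intro mult_left_mono energy_mono) auto
  then have "((1 - r)\<^sup>2 + pi\<^sup>2 * r / (6 * (real N + 1)\<^sup>2)) * energy N y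
      \<le> (1 - r) * energy N y - r * (1 - r) * energy (N - 1) y + r * energy N (bidiag 1 * y)"
    using 1 by (simp add: power2_eq_square algebra_simps)
  also have "\<dots> = energy N (bidiag (of_real r) * y)"
    by (simp only: energy_bidiag_real)
  also have "\<dots> \<le> energy N (bidiag \<mu> * f)"
    unfolding energy_def
  proof (rule sum_mono)
    fix j
    define a b where "a = fps_nth f j" and "b = (if j = 0 then 0 else fps_nth f (j - 1))"
    have "fps_nth (bidiag (of_real r) * y) j = complex_of_real (cmod a - cmod (\<mu> * b))"
      by (simp add: y_def a_def b_def bidiag_mult_nth r_def norm_mult)
    then have "cmod (fps_nth (bidiag (of_real r) * y) j) = \<bar>cmod a - cmod (\<mu> * b)\<bar>"
      by (simp only: norm_of_real)
    also have "\<dots> \<le> cmod (a - \<mu> * b)" by (rule norm_triangle_ineq3)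
    also have "\<dots> = cmod (fps_nth (bidiag \<mu> * f) j)"
      by (simp only: a_def b_def bidiag_mult_nth)
    finally show "(cmod (fps_nth (bidiag (of_real r) * y) j))\<^sup>2 \<le> (cmod (fps_nth (bidiag \<mu> * f) j))\<^sup>2"
      by (rule power_mono) simp
  qed
  finally show ?thesis unfolding y r_def .
qed

lemma energy_bidiag_power_ge:
  assumes "cmod \<mu> \<le> 1"
  shows "((1 - cmod \<mu>)\<^sup>2 + pi\<^sup>2 * cmod \<mu> / (6 * (real N + 1)\<^sup>2)) ^ p * energy N f
           \<le> energy N (bidiag \<mu> ^ p * f)"
proof (induction p)
  case (Suc p)
  let ?\<beta> = "(1 - cmod \<mu>)\<^sup>2 + pi\<^sup>2 * cmod \<mu> / (6 * (real N + 1)\<^sup>2)"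
  have "?\<beta> ^ Suc p * energy N f = ?\<beta> * (?\<beta> ^ p * energy N f)" by simp
  also have "\<dots> \<le> ?\<beta> * energy N (bidiag \<mu> ^ p * f)"
    by (intro mult_left_mono Suc.IH) auto
  also have "\<dots> \<le> energy N (bidiag \<mu> * (bidiag \<mu> ^ p * f))"
    by (rule energy_bidiag_ge[OF assms])
  finally show ?case by (simp add: mult.assoc)
qed auto

text \<open>Summed over a range beyond the support of \<open>f\<close>, so that the boundary term of
  \<open>energy_bidiag_real\<close> vanishes, the energy of \<open>(1 - r X) f\<close> is exactly
  \<open>(1 - r)\<^sup>2\<close> times that of \<open>f\<close> plus \<open>r\<close> times that of \<open>(1 - X) f\<close>; moreover multiplication by
  \<open>1 - r X\<close> increases the energy of \<open>(1 - X) f\<close> at most fourfold. Iterating gives the recursion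
  for the constant.\<close>

fun gap_const :: "real \<Rightarrow> nat \<Rightarrow> real" where
  "gap_const r 0 = 0"
| "gap_const r (Suc p) = (1 - r) ^ (2 * p) * r + 4 * gap_const r p"

lemma gap_const_nonneg: "0 \<le> r \<Longrightarrow> gap_const r p \<ge> 0"
  by (induction p) auto

lemma energy_bidiag_power_le:
  assumes "0 \<le> r" "r \<le> 1" "\<And>j. j \<ge> n \<Longrightarrow> fps_nth f j = 0" "n + p \<le> M"
  shows "energy M (bidiag (of_real r) ^ p * f)
           \<le> (1 - r) ^ (2 * p) * energy M f + gap_const r p * energy M (bidiag 1 * f)"
  using assms(3,4)
proof (induction p arbitrary: n f)
  case (Suc p)
  \<comment> \<open>One factor is absorbed into \<open>y\<close>, whose support is longer by one;
    the condition n + p \<le> M is unchanged by this trade.\<close>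
  define y where "y = bidiag (of_real r) * f"
  have supp: "fps_nth y j = 0" if "j \<ge> Suc n" for j
    using that Suc.prems(1) by (simp add: y_def bidiag_mult_nth)
  have "energy M (bidiag (of_real r) ^ Suc p * f) = energy M (bidiag (of_real r) ^ p * y)"
    by (simp add: y_def mult_ac)
  also have "\<dots> \<le> (1 - r) ^ (2 * p) * energy M y + gap_const r p * energy M (bidiag 1 * y)"
    using Suc.prems by (intro Suc.IH[of "Suc n"] supp) auto
  finally have step: "energy M (bidiag (of_real r) ^ Suc p * f)
      \<le> (1 - r) ^ (2 * p) * energy M y + gap_const r p * energy M (bidiag 1 * y)" .
  have first: "energy M y = (1 - r)\<^sup>2 * energy M f + r * energy M (bidiag 1 * f)"
  proof -
    \<comment> \<open>Position M - 1 lies outside the support, so the boundary energy is the full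
      energy.\<close>
    have "energy (M - 1) f = energy M f"
      using Suc.prems energy_eqI_support[of n f "M - 1"] energy_eqI_support[of n f M] by simp
    then show ?thesis
      unfolding y_def energy_bidiag_real by (simp add: power2_eq_square algebra_simps)
  qed
  have "energy M (bidiag 1 * y) \<le> 4 * energy M (bidiag 1 * f)"
  proof -
    let ?d = "bidiag 1 * f"
    \<comment> \<open>The factors commute: the differences of \<open>y\<close> are 1 - r X applied
      to the differences of f.\<close>
    have "energy M (bidiag 1 * y) = energy M (bidiag (of_real r) * ?d)"
      by (simp add: y_def mult_ac)
    also have "\<dots> \<le> (\<Sum>j<M. 2 * (cmod (fps_nth ?d j))\<^sup>2
        + 2 * (cmod (fps_nth (fps_X ^ 1 * ?d) j))\<^sup>2)"
      unfolding energy_def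
    proof (rule sum_mono)
      fix j
      define a b where "a = cmod (fps_nth ?d j)" and "b = cmod (fps_nth (fps_X ^ 1 * ?d) j)"
      have "cmod (fps_nth (bidiag (of_real r) * ?d) j) \<le> a + r * b"
        unfolding bidiag_mult_nth[of "of_real r"] a_def b_def using assms(1)
        by (intro order_trans[OF norm_triangle_ineq4]) (auto simp: norm_mult)
      also have "r * b \<le> b" using assms(1,2) by (simp add: b_def mult_left_le_one_le)
      finally have "cmod (fps_nth (bidiag (of_real r) * ?d) j) \<le> a + b" by simp
      then have "(cmod (fps_nth (bidiag (of_real r) * ?d) j))\<^sup>2 \<le> (a + b)\<^sup>2"
        by (rule power_mono) simp
      also have "\<dots> \<le> 2 * a\<^sup>2 + 2 * b\<^sup>2"
        using zero_le_power2[of "a - b"] by (simp add: power2_eq_square algebra_simps)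
      finally show "(cmod (fps_nth (bidiag (of_real r) * ?d) j))\<^sup>2 \<le> 2 * a\<^sup>2 + 2 * b\<^sup>2" .
    qed
    also have "\<dots> = 2 * energy M ?d + 2 * energy (M - 1) ?d"
      using energy_shift[of M 1 ?d] unfolding energy_def by (simp only: sum.distrib flip: sum_distrib_left)
    also have "\<dots> \<le> 4 * energy M ?d"
      using energy_mono[of "M - 1" M ?d] by simp
    finally show ?thesis .
  qed
  then have "gap_const r p * energy M (bidiag 1 * y) \<le> gap_const r p * (4 * energy M (bidiag 1 * f))"
    using gap_const_nonneg[OF assms(1)] by (rule mult_left_mono)
  then have "energy M (bidiag (of_real r) ^ Suc p * f)
      \<le> (1 - r) ^ (2 * p) * ((1 - r)\<^sup>2 * energy M f + r * energy M (bidiag 1 * f))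
        + gap_const r p * (4 * energy M (bidiag 1 * f))"
    using step unfolding first by linarith
  also have "\<dots> = ((1 - r) ^ (2 * p) * (1 - r)\<^sup>2) * energy M f
      + gap_const r (Suc p) * energy M (bidiag 1 * f)"
    unfolding gap_const.simps by (simp only: distrib_left distrib_right mult_ac)
  finally show ?case by (simp flip: power_add)
qed auto

section \<open>Sine test vectors and rotation by the phase of mu\<close>

text \<open>Discrete Dirichlet eigenvector when the angle is pi / (n + 1): with the index starting
  at \<open>Suc j\<close>, the sine vanishes just before the first sample and just after the
  last.\<close>

definition sine_series :: "nat \<Rightarrow> real \<Rightarrow> complex fps" where
  "sine_series n \<theta> = Abs_fps (\<lambda>j. if j < n then of_real (sin (real (Suc j) * \<theta>)) else 0)"

text \<open>The three-term recurrence of the sine gives the closed form by induction on the number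
  of terms. The angle is left free and the boundary term kept, because the angle pi / N is later
  combined with only N - 2 samples.\<close>

lemma energy_bidiag_sine:
  "energy n (bidiag (of_real r) * sine_series n \<theta>)
    = (1 + r\<^sup>2 - 2 * r * cos \<theta>) * energy n (sine_series n \<theta>)
      + r * sin (real n * \<theta>) * (sin (real (Suc n) * \<theta>) - r * sin (real n * \<theta>))"
proof -
  define s where "s j = sin (real j * \<theta>)" for j
  have rec: "s (Suc (Suc j)) = 2 * cos \<theta> * s (Suc j) - s j" for j
  proof -
    have "s (Suc (Suc j)) = sin (real (Suc j) * \<theta> + \<theta>)" "s j = sin (real (Suc j) * \<theta> - \<theta>)"
      by (simp_all add: s_def algebra_simps)
    then show ?thesis unfolding s_def[of "Suc j"] by (simp only: sin_add sin_diff) simp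
  qed
  have id: "(\<Sum>j<m. (s (Suc j) - r * s j)\<^sup>2)
      = (1 + r\<^sup>2 - 2 * r * cos \<theta>) * (\<Sum>j<m. (s (Suc j))\<^sup>2) + r * s m * (s (Suc m) - r * s m)" for m
  proof (induction m)
    case (Suc m)
    show ?case unfolding sum.lessThan_Suc Suc.IH rec[of m]
      by (simp add: power2_eq_square algebra_simps)
  qed (simp add: s_def)
  have "(cmod (fps_nth (bidiag (of_real r) * sine_series n \<theta>) j))\<^sup>2 = (s (Suc j) - r * s j)\<^sup>2"
    if "j < n" for j
  proof -
    have "fps_nth (bidiag (of_real r) * sine_series n \<theta>) j = of_real (s (Suc j) - r * s j)"
      using that by (cases j) (auto simp: bidiag_mult_nth sine_series_def s_def)
    then show ?thesis by (simp only: norm_of_real power2_abs)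
  qed
  then have 1: "energy n (bidiag (of_real r) * sine_series n \<theta>) = (\<Sum>j<n. (s (Suc j) - r * s j)\<^sup>2)"
    by (simp add: energy_def)
  have 2: "energy n (sine_series n \<theta>) = (\<Sum>j<n. (s (Suc j))\<^sup>2)"
    unfolding energy_def by (intro sum.cong) (auto simp: sine_series_def s_def simp del: of_nat_Suc)
  show ?thesis unfolding 1 2 id by (simp add: s_def)
qed

lemma energy_sine_pos:
  assumes "0 < \<theta>" "\<theta> < pi" "n > 0"
  shows "energy n (sine_series n \<theta>) > 0"
proof -
  have "0 < (cmod (fps_nth (sine_series n \<theta>) 0))\<^sup>2"
    using assms sin_gt_zero[of \<theta>] by (simp add: sine_series_def)
  also have "\<dots> \<le> energy n (sine_series n \<theta>)"
    unfolding energy_def using assms by (intro member_le_sum) auto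
  finally show ?thesis .
qed

text \<open>One position past the support the difference is -sin (n \<theta>). Its square cancels
  the boundary term, since sin ((n + 1) \<theta>) = sin pi = 0, and the Dirichlet eigenvalue
  remains.\<close>

lemma energy_difference_sine:
  assumes "n < M"
  defines "\<theta> \<equiv> pi / (real n + 1)"
  shows "energy M (bidiag 1 * sine_series n \<theta>) = 2 * (1 - cos \<theta>) * energy n (sine_series n \<theta>)"
proof -
  define g where "g = bidiag 1 * sine_series n \<theta>"
  have "energy M g = energy (Suc n) g"
    using assms(1) by (intro energy_eqI_support) (auto simp: g_def one_minus_X_mult_nth sine_series_def)
  also have "\<dots> = energy n g + (cmod (fps_nth g n))\<^sup>2"
    by (simp add: energy_def)
  also have "(cmod (fps_nth g n))\<^sup>2 = (sin (real n * \<theta>))\<^sup>2"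
    by (cases n) (auto simp: g_def one_minus_X_mult_nth sine_series_def simp del: of_nat_Suc simp flip: of_real_mult)
  also have "energy n g = 2 * (1 - cos \<theta>) * energy n (sine_series n \<theta>) - (sin (real n * \<theta>))\<^sup>2"
  proof -
    have "sin (real (Suc n) * \<theta>) = 0" by (simp add: \<theta>_def add.commute)
    then show ?thesis unfolding g_def
      using energy_bidiag_sine[of n 1 \<theta>] by (simp add: power2_eq_square algebra_simps)
  qed
  finally show ?thesis by (simp add: g_def)
qed

text \<open>Substituting u X for X is a ring homomorphism that sends 1 - a X to 1 - a u X.\<close>

lemma fps_compose_power_bidiag:
  "(bidiag a ^ p * f) oo (fps_const u * fps_X) = bidiag (a * u) ^ p * (f oo (fps_const u * fps_X))"
proof -
  have "bidiag a oo (fps_const u * fps_X) = bidiag (a * u)"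
    unfolding fps_compose_linear by (auto simp: fps_eq_iff fps_X_def)
  then show ?thesis
    by (simp add: fps_compose_mult_distrib flip: fps_compose_power)
qed

lemma energy_rotate: "cmod u = 1 \<Longrightarrow> energy N (f oo (fps_const u * fps_X)) = energy N f"
  unfolding fps_compose_linear energy_def by (simp add: norm_mult norm_power)

lemma energy_bidiag_rotate:
  fixes \<mu> :: complex and f :: "complex fps"
  obtains g where "\<And>N. energy N g = energy N f"
    and "\<And>N p. energy N (bidiag \<mu> ^ p * g) = energy N (bidiag (of_real (cmod \<mu>)) ^ p * f)"
proof -
  \<comment> \<open>\<open>sgn 0\<close> is 0 and not of modulus one, so mu = 0 needs the value
    1.\<close>
  define u where "u = (if \<mu> = 0 then 1 else sgn \<mu>)"
  have u: "cmod u = 1" "of_real (cmod \<mu>) * u = \<mu>"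
    by (auto simp: u_def sgn_eq norm_divide)
  show ?thesis
    by (rule that[of "f oo (fps_const u * fps_X)"])
      (use u in \<open>auto simp: energy_rotate simp flip: fps_compose_power_bidiag[of "of_real (cmod \<mu>)" _ _ u, unfolded u(2)]\<close>)
qed


section \<open>Operator norms of truncated multiplications\<close>

text \<open>Cauchy-Schwarz in each coefficient. The crude constant suffices: it serves only to make
  the supremum in \<open>trunc_norm\<close> finite and to show that a series with zero truncation
  has products with zero truncation.\<close>

lemma energy_mult_le: "energy N (h * g) \<le> real N * energy N h * energy N g"
proof -
  have "(cmod (fps_nth (h * g) j))\<^sup>2 \<le> energy N h * energy N g" if "j < N" for j
  proof -
    let ?a = "\<lambda>i. cmod (fps_nth h i)" and ?b = "\<lambda>i. cmod (fps_nth g (j - i))"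
    have "cmod (fps_nth (h * g) j) \<le> (\<Sum>i\<le>j. \<bar>?a i\<bar> * \<bar>?b i\<bar>)"
      unfolding fps_mult_nth atLeast0AtMost by (rule order_trans[OF norm_sum]) (simp add: norm_mult)
    also have "\<dots> \<le> L2_set ?a {..j} * L2_set ?b {..j}" by (rule L2_set_mult_ineq)
    finally have "(cmod (fps_nth (h * g) j))\<^sup>2 \<le> (L2_set ?a {..j} * L2_set ?b {..j})\<^sup>2"
      by (rule power_mono) simp
    also have "\<dots> = (\<Sum>i\<le>j. (?a i)\<^sup>2) * (\<Sum>i\<le>j. (?b i)\<^sup>2)"
      by (simp add: L2_set_def power_mult_distrib sum_nonneg)
    also have "(\<Sum>i\<le>j. (?b i)\<^sup>2) = (\<Sum>i\<le>j. (cmod (fps_nth g i))\<^sup>2)"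
      by (rule sum.reindex_bij_witness[of _ "\<lambda>i. j - i" "\<lambda>i. j - i"]) auto
    also have "(\<Sum>i\<le>j. (?a i)\<^sup>2) * \<dots> \<le> energy N h * energy N g"
      using energy_mono[of "Suc j" N] that
      by (intro mult_mono) (auto simp: energy_def lessThan_Suc_atMost intro: sum_nonneg)
    finally show ?thesis .
  qed
  then have "energy N (h * g) \<le> (\<Sum>j<N. energy N h * energy N g)"
    unfolding energy_def[of N "h * g"] by (intro sum_mono) auto
  then show ?thesis by simp
qed

text \<open>The Euclidean operator norm of the \<open>N \<times> N\<close> lower triangular Toeplitz matrix whose first column
  consists of the coefficients of \<open>h\<close>.\<close>

definition trunc_norm :: "nat \<Rightarrow> complex fps \<Rightarrow> real" where
  "trunc_norm N h = (SUP g\<in>{g. energy N g > 0}. sqrt (energy N (h * g) / energy N g))"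

lemma bdd_above_trunc_norm:
  "bdd_above ((\<lambda>g. sqrt (energy N (h * g) / energy N g)) ` {g. energy N g > 0})"
proof (rule bdd_aboveI2)
  fix g assume "g \<in> {g. energy N g > 0}"
  then show "sqrt (energy N (h * g) / energy N g) \<le> sqrt (real N * energy N h)"
    using energy_mult_le[of N h g] by (simp add: pos_divide_le_eq)
qed

lemma energy_one_pos: "N > 0 \<Longrightarrow> energy N 1 > 0"
  using energy_mono[of 1 N 1] by (simp add: energy_def)

lemma trunc_norm_ge:
  assumes "energy N g > 0" "c \<ge> 0" "c\<^sup>2 * energy N g \<le> energy N (h * g)"
  shows "c \<le> trunc_norm N h"
proof -
  have "c \<le> sqrt (energy N (h * g) / energy N g)"
    using assms by (intro real_le_rsqrt) (simp add: pos_le_divide_eq)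
  also have "\<dots> \<le> trunc_norm N h"
    unfolding trunc_norm_def using assms(1) by (intro cSUP_upper bdd_above_trunc_norm) auto
  finally show ?thesis .
qed

lemma trunc_norm_le:
  assumes "N > 0" "c \<ge> 0" "\<And>g. energy N (h * g) \<le> c\<^sup>2 * energy N g"
  shows "trunc_norm N h \<le> c"
  unfolding trunc_norm_def
proof (rule cSUP_least)
  show "{g. energy N g > 0} \<noteq> {}" using energy_one_pos[OF assms(1)] by blast
  fix g assume "g \<in> {g. energy N g > 0}"
  then show "sqrt (energy N (h * g) / energy N g) \<le> c"
    using assms by (intro real_le_lsqrt) (auto simp: pos_divide_le_eq)
qed

lemma trunc_norm_nonneg: "N > 0 \<Longrightarrow> trunc_norm N h \<ge> 0"
  using energy_one_pos by (intro trunc_norm_ge) auto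

lemma energy_mult_le_trunc_norm: "energy N (h * g) \<le> (trunc_norm N h)\<^sup>2 * energy N g"
proof (cases "energy N g > 0")
  case True
  then have "sqrt (energy N (h * g) / energy N g) \<le> trunc_norm N h"
    by (intro trunc_norm_ge[of N g]) auto
  then have "(sqrt (energy N (h * g) / energy N g))\<^sup>2 \<le> (trunc_norm N h)\<^sup>2"
    by (rule power_mono) simp
  then show ?thesis using True by (simp add: pos_divide_le_eq)
next
  case False
  then have "energy N g = 0" using energy_nonneg[of N g] by linarith
  then show ?thesis using energy_mult_le[of N h g] by simp
qed

lemma trunc_norm_const_mult:
  assumes "N > 0"
  shows "trunc_norm N (fps_const c * h) = cmod c * trunc_norm N h"
proof -
  have le: "trunc_norm N (fps_const c * h) \<le> cmod c * trunc_norm N h" for c h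
  proof (rule trunc_norm_le)
    show "energy N (fps_const c * h * g) \<le> (cmod c * trunc_norm N h)\<^sup>2 * energy N g" for g
      using mult_left_mono[OF energy_mult_le_trunc_norm[of N h g], of "(cmod c)\<^sup>2"]
      by (simp add: energy_const_mult mult.assoc power_mult_distrib)
  qed (use assms trunc_norm_nonneg in auto)
  show ?thesis
  proof (cases "c = 0")
    case True
    then show ?thesis using le[of c h] trunc_norm_nonneg[OF assms, of "fps_const c * h"] by simp
  next
    case False
    \<comment> \<open>The reverse inequality is the first one applied to the scalar
      \<open>inverse c\<close>.\<close>
    then have "trunc_norm N h \<le> inverse (cmod c) * trunc_norm N (fps_const c * h)"
      using le[of "inverse c" "fps_const c * h"] by (simp add: norm_inverse flip: mult.assoc)
    then have "cmod c * trunc_norm N h \<le> trunc_norm N (fps_const c * h)"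
      using False by (simp add: field_simps)
    with le show ?thesis by (rule antisym)
  qed
qed

section \<open>Two-sided norm bounds for the kernels\<close>

text \<open>Up to a scalar, F-relaxation has m = p = 1 and FCF-relaxation has m = 2, p = 1; the
  family is closed under powers. The exponent m counts the vanishing leading diagonals of the
  Toeplitz matrix.\<close>

definition kernel :: "nat \<Rightarrow> nat \<Rightarrow> complex \<Rightarrow> complex fps" where
  "kernel m p \<mu> = fps_X ^ m * inverse (bidiag \<mu> ^ p)"

lemma kernel_power: "kernel m q \<mu> ^ p = kernel (m * p) (q * p) \<mu>"
  by (simp add: kernel_def power_mult_distrib fps_inverse_power flip: power_mult)

lemma bidiag_power_nth_0: "fps_nth (bidiag \<mu> ^ p) 0 = 1"
  by (simp add: fps_power_zeroth)

lemma bidiag_power_mult_inverse: "bidiag \<mu> ^ p * (inverse (bidiag \<mu> ^ p) * g) = g"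
  using inverse_mult_eq_1'[of "bidiag \<mu> ^ p"] by (simp add: bidiag_power_nth_0 flip: mult.assoc)

lemma trunc_norm_kernel_le:
  assumes "cmod \<mu> < 1" "m > 0" "N > 0"
  shows "trunc_norm N (kernel m p \<mu>)
    \<le> 1 / sqrt (((1 - cmod \<mu>)\<^sup>2 + pi\<^sup>2 * cmod \<mu> / (6 * (real N)\<^sup>2)) ^ p)"
proof (rule trunc_norm_le)
  let ?\<beta> = "(1 - cmod \<mu>)\<^sup>2 + pi\<^sup>2 * cmod \<mu> / (6 * (real N)\<^sup>2)"
  have pos: "?\<beta> > 0" using assms(1) by (intro add_pos_nonneg) auto
  fix g
  \<comment> \<open>Dividing out makes \<open>g\<close> the image of \<open>f\<close> under (1 - mu
    X)^p, so a lower energy bound for that image is an upper norm bound.\<close>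
  define f where "f = inverse (bidiag \<mu> ^ p) * g"
  have "energy N (kernel m p \<mu> * g) = energy (N - m) f"
    by (simp add: kernel_def f_def mult.assoc energy_shift)
  \<comment> \<open>At least one coefficient is lost to the shift. Working at length N - 1 turns the
    N + 1 of the energy bound into N.\<close>
  also have "\<dots> \<le> energy (N - 1) f" using assms(2) by (intro energy_mono) simp
  finally have "?\<beta> ^ p * energy N (kernel m p \<mu> * g) \<le> ?\<beta> ^ p * energy (N - 1) f"
    using pos by (intro mult_left_mono) auto
  also have "\<dots> \<le> energy (N - 1) (bidiag \<mu> ^ p * f)"
    using energy_bidiag_power_ge[of \<mu> "N - 1" p f] assms by (simp add: of_nat_diff)
  also have "\<dots> = energy (N - 1) g" by (simp only: f_def bidiag_power_mult_inverse)
  also have "\<dots> \<le> energy N g" by (rule energy_mono) simp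
  finally show "energy N (kernel m p \<mu> * g) \<le> (1 / sqrt (?\<beta> ^ p))\<^sup>2 * energy N g"
    using pos by (simp add: power_divide pos_le_divide_eq mult.commute)
qed (use assms in auto)

text \<open>Here \<open>f\<close> is the visible output and (1 - mu X)^p f its input; a small input
  energy means a large norm.\<close>

lemma trunc_norm_kernel_ge:
  assumes "energy n f > 0" "energy n (bidiag \<mu> ^ p * f) \<le> B * energy n f" "B > 0" "N = n + m"
  shows "1 / sqrt B \<le> trunc_norm N (kernel m p \<mu>)"
proof (rule trunc_norm_ge)
  \<comment> \<open>Input coefficients from n on are shifted out by X^m and could only add to the
    input energy, so they are cut off.\<close>
  define g where "g = fps_cutoff n (bidiag \<mu> ^ p * f)"
  have "energy N g = energy n g"
    using assms(4) by (intro energy_eqI_support) (auto simp: g_def)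
  also have "\<dots> = energy n (bidiag \<mu> ^ p * f)"
    by (intro energy_cong) (simp add: g_def)
  finally have g: "energy N g = energy n (bidiag \<mu> ^ p * f)" .
  have "energy N (kernel m p \<mu> * g) = energy n (inverse (bidiag \<mu> ^ p) * g)"
    using assms(4) by (simp add: kernel_def mult.assoc energy_shift)
  also have "\<dots> = energy n (inverse (bidiag \<mu> ^ p) * (bidiag \<mu> ^ p * f))"
    by (intro energy_cong) (auto simp: fps_mult_nth g_def intro!: sum.cong)
  also have "inverse (bidiag \<mu> ^ p) * (bidiag \<mu> ^ p * f) = f"
    using bidiag_power_mult_inverse[of \<mu> p f] by (simp add: mult_ac)
  finally have k: "energy N (kernel m p \<mu> * g) = energy n f" .
  show "energy N g > 0"
  proof (rule ccontr)
    assume "\<not> energy N g > 0"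
    then have "energy N g = 0" using energy_nonneg[of N g] by linarith
    then show False using energy_mult_le[of N "kernel m p \<mu>" g] k assms(1) by simp
  qed
  show "(1 / sqrt B)\<^sup>2 * energy N g \<le> energy N (kernel m p \<mu> * g)"
    unfolding g k using assms(2,3) by (simp add: power_divide pos_divide_le_eq mult.commute)
qed (use assms in auto)

text \<open>The input is a sine vector with n = N - m samples and angle pi / (n + 1), rotated by the
  phase of mu. For p = 1 the constant \<open>gap_const\<close> is just the modulus of mu.\<close>

lemma trunc_norm_kernel_ge_sine:
  assumes "cmod \<mu> < 1" "m < N"
  shows "1 / sqrt ((1 - cmod \<mu>) ^ (2 * p)
      + gap_const (cmod \<mu>) p * (pi\<^sup>2 / (real (N - m) + 1)\<^sup>2)) \<le> trunc_norm N (kernel m p \<mu>)"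
proof -
  define r n where "r = cmod \<mu>" and "n = N - m"
  define \<theta> where "\<theta> = pi / (real n + 1)"
  have r: "0 \<le> r" "r < 1" and n: "n > 0" "N = n + m" using assms by (auto simp: r_def n_def)
  let ?B = "(1 - r) ^ (2 * p) + gap_const r p * (pi\<^sup>2 / (real n + 1)\<^sup>2)"
  let ?s = "sine_series n \<theta>"
  obtain f where f: "\<And>N. energy N f = energy N ?s"
    "\<And>N p. energy N (bidiag \<mu> ^ p * f) = energy N (bidiag (of_real r) ^ p * ?s)"
    unfolding r_def using energy_bidiag_rotate[of ?s \<mu>] by metis
  have pos: "energy n f > 0"
    unfolding f using n(1) by (intro energy_sine_pos) (auto simp: \<theta>_def pos_divide_less_eq)
  \<comment> \<open>The range n + 1 + p contains the support of the whole product, as the exact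
    power estimate requires, and the extra position used by the difference energy.\<close>
  have "energy n (bidiag \<mu> ^ p * f) \<le> energy (Suc n + p) (bidiag (of_real r) ^ p * ?s)"
    unfolding f by (rule energy_mono) simp
  also have "\<dots> \<le> (1 - r) ^ (2 * p) * energy (Suc n + p) ?s
      + gap_const r p * energy (Suc n + p) (bidiag 1 * ?s)"
    using r by (intro energy_bidiag_power_le[of _ n]) (auto simp: sine_series_def)
  also have "energy (Suc n + p) (bidiag 1 * ?s) = 2 * (1 - cos \<theta>) * energy n f"
    unfolding f \<theta>_def by (rule energy_difference_sine) simp
  also have "energy (Suc n + p) ?s = energy n f"
    unfolding f by (rule energy_eqI_support) (auto simp: sine_series_def)
  also have "(1 - r) ^ (2 * p) * energy n f + gap_const r p * (2 * (1 - cos \<theta>) * energy n f)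
      = ((1 - r) ^ (2 * p) + gap_const r p * (2 * (1 - cos \<theta>))) * energy n f"
    by (simp add: algebra_simps)
  also have "\<dots> \<le> ?B * energy n f"
    using one_minus_cos_le[of \<theta>] pos r gap_const_nonneg[OF r(1)]
    by (intro mult_right_mono add_left_mono mult_left_mono) (auto simp: \<theta>_def power_divide)
  finally have "energy n (bidiag \<mu> ^ p * f) \<le> ?B * energy n f" .
  moreover have "?B > 0"
    using r gap_const_nonneg[OF r(1)] by (intro add_pos_nonneg) auto
  ultimately show ?thesis
    using trunc_norm_kernel_ge[OF pos _ _ n(2)] by (simp add: r_def n_def)
qed

text \<open>Only \<open>N - 2\<close> sine samples are available here, so taking the angle \<open>pi / N\<close> leaves a boundary term;
  the assumption on \<open>cos (pi / N)\<close> says exactly that this term is not positive.\<close>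

lemma trunc_norm_kernel_ge_two:
  assumes "cmod \<mu> < 1" "N \<ge> 2" "2 * cmod \<mu> * cos (pi / real N) \<ge> 1"
  shows "1 / sqrt ((1 - cmod \<mu>)\<^sup>2 + pi\<^sup>2 * cmod \<mu> / (real N)\<^sup>2) \<le> trunc_norm N (kernel 2 1 \<mu>)"
proof -
  define r n where "r = cmod \<mu>" and "n = N - 2"
  define \<theta> where "\<theta> = pi / real N"
  \<comment> \<open>For N = 2 the cosine is zero and the assumption fails, so n is positive.\<close>
  have "N \<noteq> 2" using assms(3) by auto
  then have r: "0 \<le> r" "r < 1" and n: "n > 0" "N = n + 2" using assms by (auto simp: r_def n_def)
  let ?B = "(1 - r)\<^sup>2 + pi\<^sup>2 * r / (real N)\<^sup>2"
  let ?s = "sine_series n \<theta>"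
  obtain f where f: "\<And>N. energy N f = energy N ?s"
    "\<And>N p. energy N (bidiag \<mu> ^ p * f) = energy N (bidiag (of_real r) ^ p * ?s)"
    unfolding r_def using energy_bidiag_rotate[of ?s \<mu>] by metis
  have \<theta>: "0 < \<theta>" "\<theta> < pi" "2 * \<theta> \<le> pi"
    using n by (auto simp: \<theta>_def field_simps intro: add_pos_nonneg)
  have pos: "energy n f > 0"
    unfolding f using n(1) \<theta> by (intro energy_sine_pos)
  \<comment> \<open>The angles are n \<theta> = pi - 2 \<theta> and (n + 1) \<theta> = pi -
    \<theta>.\<close>
  have sn: "sin (real n * \<theta>) = 2 * sin \<theta> * cos \<theta>" and sn1: "sin (real (Suc n) * \<theta>) = sin \<theta>"
  proof -
    have "real n * \<theta> = pi - 2 * \<theta>" "real (Suc n) * \<theta> = pi - \<theta>"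
      by (auto simp: \<theta>_def n(2) field_simps)
    then show "sin (real n * \<theta>) = 2 * sin \<theta> * cos \<theta>" "sin (real (Suc n) * \<theta>) = sin \<theta>"
      by (simp_all only: sin_pi_minus sin_double)
  qed
  have "sin \<theta> - r * (2 * sin \<theta> * cos \<theta>) = sin \<theta> * (1 - 2 * r * cos \<theta>)"
    by (simp add: algebra_simps)
  also have "\<dots> \<le> 0"
    using assms(3) sin_gt_zero[OF \<theta>(1,2)] by (intro mult_nonneg_nonpos) (auto simp: r_def \<theta>_def)
  finally have "r * sin (real n * \<theta>) * (sin (real (Suc n) * \<theta>) - r * sin (real n * \<theta>)) \<le> 0"
    unfolding sn sn1 using r sin_gt_zero[OF \<theta>(1,2)] cos_ge_zero[of \<theta>] \<theta>
    by (intro mult_nonneg_nonpos mult_nonneg_nonneg) auto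
  then have "energy n (bidiag \<mu> ^ 1 * f) \<le> (1 + r\<^sup>2 - 2 * r * cos \<theta>) * energy n f"
    unfolding f using energy_bidiag_sine[of n r \<theta>] by simp
  also have "1 + r\<^sup>2 - 2 * r * cos \<theta> = (1 - r)\<^sup>2 + r * (2 * (1 - cos \<theta>))"
    by (simp add: power2_eq_square algebra_simps)
  also have "(\<dots>) * energy n f \<le> ?B * energy n f"
  proof (intro mult_right_mono add_left_mono)
    have "r * (2 * (1 - cos \<theta>)) \<le> r * \<theta>\<^sup>2"
      using one_minus_cos_le[of \<theta>] r by (intro mult_left_mono) auto
    then show "r * (2 * (1 - cos \<theta>)) \<le> pi\<^sup>2 * r / (real N)\<^sup>2"
      by (simp add: \<theta>_def power_divide mult.commute)
  qed simp
  finally have "energy n (bidiag \<mu> ^ 1 * f) \<le> ?B * energy n f" .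
  moreover have "?B > 0" using r by (intro add_pos_nonneg) auto
  ultimately show ?thesis
    using trunc_norm_kernel_ge[OF pos _ _ n(2)] by (simp add: r_def)
qed

text \<open>\<open>\<epsilon>\<close> is defined by solving the claimed equation, so only its order
  is left to prove: the upper norm bound bounds it below and the sine vector bounds it above. A
  positive modulus of mu keeps the lower constant positive.\<close>

lemma trunc_norm_kernel_gap:
  assumes "0 < cmod \<mu>" "cmod \<mu> < 1" "m > 0" "p > 0"
  obtains \<epsilon> :: "nat \<Rightarrow> real" where "\<And>N. \<epsilon> N > 0" "\<epsilon> \<in> \<Theta>(\<lambda>N. 1 / (real N)\<^sup>2)"
    "\<And>N. N > m \<Longrightarrow> trunc_norm N (kernel m p \<mu>) = 1 / sqrt ((1 - cmod \<mu>) ^ (2 * p) + \<epsilon> N)"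
proof -
  define r where "r = cmod \<mu>"
  have r: "0 < r" "r < 1" using assms by (auto simp: r_def)
  define w where "w N = trunc_norm N (kernel m p \<mu>)" for N
  \<comment> \<open>The value 1 for N \<le> m only keeps the sequence positive where nothing is
    claimed.\<close>
  define \<epsilon> where "\<epsilon> N = (if N > m then 1 / (w N)\<^sup>2 - (1 - r) ^ (2 * p) else 1)" for N
  \<comment> \<open>\<open>c\<close> is the coefficient left when one of the p factors contributes
    its pi^2 term and the others only (1 - r)^2.\<close>
  define c C where "c = (1 - r) ^ (2 * (p - 1)) * (pi\<^sup>2 * r / 6)" and "C = gap_const r p * pi\<^sup>2"
  have c: "c > 0" and C: "C \<ge> 0"
    using r gap_const_nonneg[of r p] by (auto simp: c_def C_def)
  have w: "w N > 0" and lo: "c / (real N)\<^sup>2 \<le> \<epsilon> N" and hi: "\<epsilon> N \<le> C / (real (N - m) + 1)\<^sup>2"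
    if "N > m" for N
  proof -
    let ?B = "(1 - r) ^ (2 * p) + gap_const r p * (pi\<^sup>2 / (real (N - m) + 1)\<^sup>2)"
    have B: "?B > 0" using r gap_const_nonneg[of r p] by (intro add_pos_nonneg) auto
    have ge: "1 / sqrt ?B \<le> w N"
      using trunc_norm_kernel_ge_sine[of \<mu> m N p] that r by (simp add: r_def w_def)
    moreover have "1 / sqrt ?B > 0" using B by simp
    ultimately show w: "w N > 0" by linarith
    have "1 / ?B = (1 / sqrt ?B)\<^sup>2" using B by (simp add: power_divide)
    also have "\<dots> \<le> (w N)\<^sup>2" using ge B by (intro power_mono) auto
    finally have "1 / (w N)\<^sup>2 \<le> ?B" using B w by (simp add: field_simps)
    then show "\<epsilon> N \<le> C / (real (N - m) + 1)\<^sup>2" using that by (simp add: \<epsilon>_def C_def)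
    define b where "b = pi\<^sup>2 * r / (6 * (real N)\<^sup>2)"
    have b: "b \<ge> 0" using r by (simp add: b_def)
    have pos: "((1 - r)\<^sup>2 + b) ^ p > 0" using r b by (intro zero_less_power add_pos_nonneg) auto
    have "w N \<le> 1 / sqrt (((1 - r)\<^sup>2 + b) ^ p)"
      using trunc_norm_kernel_le[of \<mu> m N p] that r assms by (simp add: r_def w_def b_def)
    then have "(w N)\<^sup>2 \<le> (1 / sqrt (((1 - r)\<^sup>2 + b) ^ p))\<^sup>2" using w by (intro power_mono) auto
    also have "\<dots> = 1 / ((1 - r)\<^sup>2 + b) ^ p" using pos by (simp add: power_divide)
    finally have "((1 - r)\<^sup>2 + b) ^ p \<le> 1 / (w N)\<^sup>2" using pos w by (simp add: field_simps)
    moreover have "(1 - r) ^ (2 * p) + c / (real N)\<^sup>2 \<le> ((1 - r)\<^sup>2 + b) ^ p"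
    proof -
      obtain q where q: "p = Suc q" using assms(4) by (cases p) auto
      have "(1 - r) ^ (2 * p) + c / (real N)\<^sup>2 = ((1 - r)\<^sup>2) ^ q * ((1 - r)\<^sup>2 + b)"
      proof -
        have "(1 - r) ^ (2 * p) = ((1 - r)\<^sup>2) ^ q * (1 - r)\<^sup>2"
          by (simp add: q flip: power_mult power_add)
        moreover have "c / (real N)\<^sup>2 = ((1 - r)\<^sup>2) ^ q * b"
          by (simp add: c_def b_def q power_mult)
        ultimately show ?thesis by (simp add: distrib_left)
      qed
      also have "\<dots> \<le> ((1 - r)\<^sup>2 + b) ^ q * ((1 - r)\<^sup>2 + b)"
        using b by (intro mult_right_mono power_mono) auto
      finally show ?thesis by (simp add: q mult.commute)
    qed
    ultimately show "c / (real N)\<^sup>2 \<le> \<epsilon> N" using that by (simp add: \<epsilon>_def)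
  qed
  have pos: "\<epsilon> N > 0" for N
  proof (cases "N > m")
    case True
    then have "0 < c / (real N)\<^sup>2" using c by simp
    with lo[OF True] show ?thesis by linarith
  qed (simp add: \<epsilon>_def)
  show ?thesis
  proof (rule that[OF pos])
    have "\<epsilon> \<in> O(\<lambda>N. 1 / (real N)\<^sup>2)"
    proof (rule bigoI)
      show "\<forall>\<^sub>F N in sequentially. norm (\<epsilon> N) \<le> 4 * C * norm (1 / (real N)\<^sup>2)"
        \<comment> \<open>From here on N \<le> 2 (N - m + 1), which costs the factor 4.\<close>
        using eventually_ge_at_top[of "2 * m + 1"]
      proof eventually_elim
        case (elim N)
        then have "(real N)\<^sup>2 \<le> (2 * (real (N - m) + 1))\<^sup>2" by (intro power_mono) auto
        then have "(real N)\<^sup>2 \<le> 4 * (real (N - m) + 1)\<^sup>2" by (simp only: power_mult_distrib) simp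
        then have "1 / (real (N - m) + 1)\<^sup>2 \<le> 4 / (real N)\<^sup>2"
          using elim by (simp add: field_simps)
        from mult_left_mono[OF this C] have "C / (real (N - m) + 1)\<^sup>2 \<le> 4 * C / (real N)\<^sup>2"
          by (simp add: mult.commute)
        with hi[of N] pos[of N] elim show ?case by simp
      qed
    qed
    moreover have "\<epsilon> \<in> \<Omega>(\<lambda>N. 1 / (real N)\<^sup>2)"
    proof (rule landau_omega.bigI[OF c])
      show "\<forall>\<^sub>F N in sequentially. c * norm (1 / (real N)\<^sup>2) \<le> norm (\<epsilon> N)"
        using eventually_gt_at_top[of m]
        by eventually_elim (use lo pos in \<open>simp add: less_imp_le\<close>)
    qed
    ultimately show "\<epsilon> \<in> \<Theta>(\<lambda>N. 1 / (real N)\<^sup>2)" by (simp add: bigtheta_def)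
    fix N assume "N > m"
    then show "trunc_norm N (kernel m p \<mu>) = 1 / sqrt ((1 - cmod \<mu>) ^ (2 * p) + \<epsilon> N)"
      using w[of N] by (simp add: \<epsilon>_def r_def[symmetric] w_def[symmetric] real_sqrt_divide)
  qed
qed

section \<open>Reduction to scalar Toeplitz matrices\<close>

lemma mat_inv_works:
  assumes "A \<in> carrier_mat n n" "B \<in> carrier_mat n n" "A * B = 1\<^sub>m n" "B * A = 1\<^sub>m n"
  shows "mat_inv A \<in> carrier_mat n n" "A * mat_inv A = 1\<^sub>m n" "mat_inv A * A = 1\<^sub>m n"
proof -
  have "A \<in> Units (ring_mat TYPE(complex) n ())"
    unfolding Units_def ring_mat_simps using assms by (auto simp: ring_mat_simps intro!: bexI[of _ B])
  then obtain C where "mat_inverse A = Some C"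
    using mat_inverse(1)[OF assms(1), of "()"] by (cases "mat_inverse A") auto
  with mat_inverse(2)[OF assms(1) this]
  show "mat_inv A \<in> carrier_mat n n" "A * mat_inv A = 1\<^sub>m n" "mat_inv A * A = 1\<^sub>m n"
    by auto
qed

lemma invertible_matE:
  assumes "invertible_mat A" "A \<in> carrier_mat n n"
  obtains B where "B \<in> carrier_mat n n" "A * B = 1\<^sub>m n" "B * A = 1\<^sub>m n"
proof -
  obtain B where B: "inverts_mat A B" "inverts_mat B A"
    using assms(1) by (auto simp: invertible_mat_def)
  have "A * B = 1\<^sub>m n" using B(1) assms(2) by (simp add: inverts_mat_def)
  moreover from B(2) have BA: "B * A = 1\<^sub>m (dim_row B)" by (simp add: inverts_mat_def)
  moreover have "dim_col B = n" "dim_row B = n"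
    using arg_cong[OF \<open>A * B = 1\<^sub>m n\<close>, of dim_col] arg_cong[OF BA, of dim_col] assms(2) by auto
  ultimately show ?thesis using that[of B] by auto
qed

text \<open>The Frobenius bound. It makes the set of quotients in \<open>induced_norm\<close>
  bounded, so that its supremum dominates each quotient.\<close>

lemma l2_norm_mult_mat_vec_le:
  assumes "A \<in> carrier_mat m n" "v \<in> carrier_vec n"
  shows "l2_norm (A *\<^sub>v v) \<le> sqrt (\<Sum>i<m. \<Sum>j<n. (cmod (A $$ (i, j)))\<^sup>2) * l2_norm v"
proof -
  have "(cmod ((A *\<^sub>v v) $ i))\<^sup>2 \<le> (\<Sum>j<n. (cmod (A $$ (i, j)))\<^sup>2) * (l2_norm v)\<^sup>2" if "i < m" for i
  proof -
    let ?a = "\<lambda>j. cmod (A $$ (i, j))" and ?b = "\<lambda>j. cmod (v $ j)"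
    have "(A *\<^sub>v v) $ i = (\<Sum>j<n. A $$ (i, j) * v $ j)"
      using assms that by (auto simp: scalar_prod_def atLeast0LessThan intro!: sum.cong)
    then have "cmod ((A *\<^sub>v v) $ i) \<le> (\<Sum>j<n. \<bar>?a j\<bar> * \<bar>?b j\<bar>)"
      by (simp only: abs_norm_cancel flip: norm_mult) (rule norm_sum)
    also have "\<dots> \<le> L2_set ?a {..<n} * L2_set ?b {..<n}" by (rule L2_set_mult_ineq)
    finally have "(cmod ((A *\<^sub>v v) $ i))\<^sup>2 \<le> (L2_set ?a {..<n} * L2_set ?b {..<n})\<^sup>2"
      by (rule power_mono) simp
    then show ?thesis
      using assms(2) by (simp add: L2_set_def l2_norm_def power_mult_distrib sum_nonneg)
  qed
  then have "(\<Sum>i<m. (cmod ((A *\<^sub>v v) $ i))\<^sup>2)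
      \<le> (\<Sum>i<m. (\<Sum>j<n. (cmod (A $$ (i, j)))\<^sup>2) * (l2_norm v)\<^sup>2)"
    by (intro sum_mono) auto
  then have "(\<Sum>i<m. (cmod ((A *\<^sub>v v) $ i))\<^sup>2) \<le> (\<Sum>i<m. \<Sum>j<n. (cmod (A $$ (i, j)))\<^sup>2) * (l2_norm v)\<^sup>2"
    by (simp only: sum_distrib_right)
  from real_sqrt_le_mono[OF this] have
    "sqrt (\<Sum>i<m. (cmod ((A *\<^sub>v v) $ i))\<^sup>2) \<le> sqrt (\<Sum>i<m. \<Sum>j<n. (cmod (A $$ (i, j)))\<^sup>2) * \<bar>l2_norm v\<bar>"
    by (simp only: real_sqrt_mult real_sqrt_abs)
  moreover have "dim_vec (A *\<^sub>v v) = m" "\<bar>l2_norm v\<bar> = l2_norm v"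
    using assms(1) by (auto simp: l2_norm_def sum_nonneg)
  ultimately show ?thesis by (simp only: l2_norm_def[of "A *\<^sub>v v"])
qed

lemma l2_norm_pos:
  assumes "v \<in> carrier_vec n" "v \<noteq> 0\<^sub>v n"
  shows "l2_norm v > 0"
proof -
  obtain i where "i < n" "v $ i \<noteq> 0" using assms by (auto simp: vec_eq_iff)
  then have "0 < (cmod (v $ i))\<^sup>2" "(cmod (v $ i))\<^sup>2 \<le> (\<Sum>i<n. (cmod (v $ i))\<^sup>2)"
    by (auto intro!: member_le_sum)
  then have "0 < (\<Sum>i<n. (cmod (v $ i))\<^sup>2)" by linarith
  then show ?thesis using assms(1) by (simp add: l2_norm_def)
qed

text \<open>An eigenvector is a test vector for the q-th power, with quotient the q-th power of the
  modulus of the eigenvalue.\<close>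

lemma eigenvalue_norm_less_1:
  assumes A: "A \<in> carrier_mat n n" and ev: "eigenvector A v \<mu>"
    and less: "induced_norm l2_norm (A ^\<^sub>m q) < 1"
  shows "cmod \<mu> < 1"
proof -
  have v: "v \<in> carrier_vec n" "v \<noteq> 0\<^sub>v n" using A ev by (auto simp: eigenvector_def)
  have Aq: "A ^\<^sub>m q \<in> carrier_mat n n" using A by simp
  let ?S = "{l2_norm (A ^\<^sub>m q *\<^sub>v v) / l2_norm v | v. v \<in> carrier_vec n \<and> v \<noteq> 0\<^sub>v n}"
  have dim: "dim_col (A ^\<^sub>m q) = n" using Aq by (rule carrier_matD)
  have "bdd_above ?S"
  proof (rule bdd_aboveI)
    fix t assume "t \<in> ?S"
    then obtain w where w: "w \<in> carrier_vec n" "w \<noteq> 0\<^sub>v n" "t = l2_norm (A ^\<^sub>m q *\<^sub>v w) / l2_norm w"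
      by blast
    show "t \<le> sqrt (\<Sum>i<n. \<Sum>j<n. (cmod ((A ^\<^sub>m q) $$ (i, j)))\<^sup>2)"
      unfolding w(3) using l2_norm_mult_mat_vec_le[OF Aq w(1)] l2_norm_pos[OF w(1,2)]
      by (simp add: pos_divide_le_eq)
  qed
  moreover have "l2_norm (A ^\<^sub>m q *\<^sub>v v) / l2_norm v \<in> ?S" using v by blast
  ultimately have "l2_norm (A ^\<^sub>m q *\<^sub>v v) / l2_norm v \<le> induced_norm l2_norm (A ^\<^sub>m q)"
    unfolding induced_norm_def dim by (rule cSup_upper[rotated])
  moreover have "l2_norm (A ^\<^sub>m q *\<^sub>v v) = cmod \<mu> ^ q * l2_norm v"
    unfolding eigenvector_pow[OF A ev] l2_norm_def
    by (simp add: norm_mult norm_power power_mult_distrib real_sqrt_mult flip: sum_distrib_left)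
  ultimately have "cmod \<mu> ^ q < 1" using less l2_norm_pos[OF v] by simp
  then show ?thesis using one_le_power[of "cmod \<mu>" q] by linarith
qed

lemma eigenvalue_nonzero:
  assumes A: "A \<in> carrier_mat n n" "invertible_mat A" and ev: "eigenvector A v \<mu>"
  shows "\<mu> \<noteq> 0"
proof
  assume "\<mu> = 0"
  have v: "v \<in> carrier_vec n" "v \<noteq> 0\<^sub>v n" "A *\<^sub>v v = 0\<^sub>v n"
    using A(1) ev \<open>\<mu> = 0\<close> by (auto simp: eigenvector_def)
  obtain B where B: "B \<in> carrier_mat n n" "B * A = 1\<^sub>m n" using invertible_matE[OF A(2,1)] by blast
  have "v = (B * A) *\<^sub>v v" using v B by simp
  also have "\<dots> = B *\<^sub>v (A *\<^sub>v v)" using v B A by (intro assoc_mult_mat_vec) auto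
  also have "\<dots> = 0\<^sub>v n" unfolding v(3) using B by (auto simp: vec_eq_iff)
  finally show False using v by simp
qed

section \<open>Block vectors and block bidiagonal matrices\<close>

lemma sum_blocks: "(\<Sum>b<n * m. f b) = (\<Sum>l<n. \<Sum>i<m. f (l * m + i))" for f :: "nat \<Rightarrow> 'a :: comm_monoid_add"
proof (induction n)
  case (Suc n)
  have add: "(\<Sum>b<a + m. f b) = (\<Sum>b<a. f b) + (\<Sum>i<m. f (a + i))" for a
    by (induction m) (auto simp: ac_simps)
  have "(\<Sum>b<Suc n * m. f b) = (\<Sum>b<n * m + m. f b)" by (simp add: add.commute)
  also have "\<dots> = (\<Sum>b<n * m. f b) + (\<Sum>i<m. f (n * m + i))" by (rule add)
  finally show ?case using Suc.IH by simp
qed auto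

lemma block_index_less: "j < Nc \<Longrightarrow> i < Nx \<Longrightarrow> j * Nx + i < Nc * Nx" for i j Nx Nc :: nat
proof -
  assume "j < Nc" "i < Nx"
  then have "j * Nx + i < Suc j * Nx" by simp
  also have "\<dots> \<le> Nc * Nx" using \<open>j < Nc\<close> by (intro mult_right_mono) auto
  finally show ?thesis .
qed

lemma block_bidiag_carrier [simp]: "block_bidiag Nx Nc D S \<in> carrier_mat (Nc * Nx) (Nc * Nx)"
  by (simp add: block_bidiag_def)

lemma block_carrier [simp]: "block Nx x j \<in> carrier_vec Nx"
  by (simp add: block_def)

lemma block_bidiag_mult_vec:
  assumes D: "D \<in> carrier_mat Nx Nx" and S: "S \<in> carrier_mat Nx Nx"
    and x: "x \<in> carrier_vec (Nc * Nx)" and j: "j < Nc"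
  shows "block Nx (block_bidiag Nx Nc D S *\<^sub>v x) j
    = D *\<^sub>v block Nx x j + (if j = 0 then 0\<^sub>v Nx else S *\<^sub>v block Nx x (j - 1))"
proof (rule eq_vecI)
  fix i assume "i < dim_vec (D *\<^sub>v block Nx x j + (if j = 0 then 0\<^sub>v Nx else S *\<^sub>v block Nx x (j - 1)))"
  then have i: "i < Nx" using S by (auto split: if_splits)
  have mv: "(A *\<^sub>v block Nx x l) $ i = (\<Sum>m<Nx. A $$ (i, m) * x $ (l * Nx + m))"
    if "A \<in> carrier_mat Nx Nx" for A l
    using that i by (auto simp: block_def scalar_prod_def atLeast0LessThan intro!: sum.cong)
  have "block Nx (block_bidiag Nx Nc D S *\<^sub>v x) j $ i
      = (\<Sum>b<Nc * Nx. block_bidiag Nx Nc D S $$ (j * Nx + i, b) * x $ b)"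
    using i x block_index_less[OF j i]
    by (auto simp: block_def block_bidiag_def scalar_prod_def atLeast0LessThan intro!: sum.cong)
  also have "\<dots> = (\<Sum>l<Nc. \<Sum>m<Nx. block_bidiag Nx Nc D S $$ (j * Nx + i, l * Nx + m) * x $ (l * Nx + m))"
    by (rule sum_blocks)
  \<comment> \<open>Since \<open>j - 1\<close> is 0 for j = 0, the subdiagonal term needs the extra
    condition.\<close>
  also have "\<dots> = (\<Sum>l<Nc. (if l = j then (D *\<^sub>v block Nx x l) $ i else 0)
      + (if l = j - 1 \<and> j \<noteq> 0 then (S *\<^sub>v block Nx x l) $ i else 0))"
  proof (rule sum.cong[OF refl])
    fix l assume "l \<in> {..<Nc}"
    have "(Nx + l * Nx + i) mod Nx = i" using i by (metis mult_Suc mod_mult_self3 mod_less)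
    with \<open>l \<in> {..<Nc}\<close> have "block_bidiag Nx Nc D S $$ (j * Nx + i, l * Nx + m)
        = (if j = l then D $$ (i, m) else if j = Suc l then S $$ (i, m) else 0)" if "m < Nx" for m
      using that i block_index_less[OF j i] block_index_less[of l Nc m Nx] by (simp add: block_bidiag_def)
    then show "(\<Sum>m<Nx. block_bidiag Nx Nc D S $$ (j * Nx + i, l * Nx + m) * x $ (l * Nx + m))
        = (if l = j then (D *\<^sub>v block Nx x l) $ i else 0)
          + (if l = j - 1 \<and> j \<noteq> 0 then (S *\<^sub>v block Nx x l) $ i else 0)"
      unfolding mv[OF D] mv[OF S] by (cases j) (auto intro!: sum.neutral)
  qed
  also have "\<dots> = (D *\<^sub>v block Nx x j) $ i + (if j = 0 then 0 else (S *\<^sub>v block Nx x (j - 1)) $ i)"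
    using j by (cases "j = 0") (auto simp: sum.distrib)
  also have "\<dots> = (D *\<^sub>v block Nx x j + (if j = 0 then 0\<^sub>v Nx else S *\<^sub>v block Nx x (j - 1))) $ i"
    using i S by auto
  finally show "block Nx (block_bidiag Nx Nc D S *\<^sub>v x) j $ i = \<dots>" .
qed (use S in \<open>auto simp: block_def\<close>)

text \<open>The matrix is lower triangular with unit diagonal, so its determinant is 1.\<close>

lemma block_bidiag_one_inverse:
  fixes Nx Nc :: nat and S :: "complex mat"
  defines "B \<equiv> block_bidiag Nx Nc (1\<^sub>m Nx) S"
  shows "mat_inv B \<in> carrier_mat (Nc * Nx) (Nc * Nx)" "B * mat_inv B = 1\<^sub>m (Nc * Nx)"
proof -
  let ?n = "Nc * Nx"
  have B: "B \<in> carrier_mat ?n ?n" by (simp add: B_def)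
  have entry: "B $$ (a, b) = (if a = b then 1 else 0)" if "a \<le> b" "b < ?n" for a b
  proof -
    have Nx: "Nx > 0" using that by (cases Nx) auto
    have "a div Nx \<le> b div Nx" using that by (intro div_le_mono)
    moreover have "a mod Nx \<noteq> b mod Nx" if "a div Nx = b div Nx" "a \<noteq> b"
      using that by (metis div_mod_decomp)
    ultimately show ?thesis using that Nx by (auto simp: B_def block_bidiag_def)
  qed
  have "det B = prod_list (diag_mat B)"
    using entry B by (intro det_lower_triangular) auto
  also have "diag_mat B = map (\<lambda>_. 1) [0..<?n]"
    unfolding diag_mat_def using entry B by (intro map_cong) auto
  also have "prod_list \<dots> = (1 :: complex)" by (simp add: map_replicate_const)
  finally have "det B \<noteq> 0" by simp
  from det_non_zero_imp_unit[OF B this, of "()"]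
  obtain C where "C \<in> carrier_mat ?n ?n" "B * C = 1\<^sub>m ?n" "C * B = 1\<^sub>m ?n"
    by (auto simp: Units_def ring_mat_simps)
  with mat_inv_works[OF B this] show "mat_inv B \<in> carrier_mat ?n ?n" "B * mat_inv B = 1\<^sub>m ?n" by auto
qed

lemma cSUP_finite_mono:
  fixes f g :: "nat \<Rightarrow> real"
  assumes "n > 0" "\<And>i. i < n \<Longrightarrow> f i \<le> g i"
  shows "(SUP i\<in>{..<n}. f i) \<le> (SUP i\<in>{..<n}. g i)"
  using assms by (intro cSUP_mono) auto

section \<open>Block operators in eigenvector coordinates\<close>

locale eigenbasis =
  fixes Nx :: nat and U :: "complex mat"
  assumes Nx_pos: "Nx > 0" and U_carrier: "U \<in> carrier_mat Nx Nx" and U_invertible: "invertible_mat U"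
begin

text \<open>Says that \<open>U\<close> conjugates \<open>D\<close> to a diagonal matrix, phrased
  through the coordinates of vectors so that sums, products and powers follow entrywise.\<close>

definition diagonalizes :: "complex mat \<Rightarrow> (nat \<Rightarrow> complex) \<Rightarrow> bool" where
  "diagonalizes D d \<longleftrightarrow> D \<in> carrier_mat Nx Nx
     \<and> (\<forall>v\<in>carrier_vec Nx. \<forall>i<Nx. (mat_inv U *\<^sub>v (D *\<^sub>v v)) $ i = d i * (mat_inv U *\<^sub>v v) $ i)"

text \<open>The generating function in the time index of the i-th eigenvector coordinate;
  multiplication by X is a delay by one coarse time step.\<close>

definition coords :: "complex vec \<Rightarrow> nat \<Rightarrow> complex fps" where
  "coords x i = Abs_fps (\<lambda>j. (mat_inv U *\<^sub>v block Nx x j) $ i)"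

text \<open>In coordinates with respect to the eigenvectors, the matrix acts on the \<open>i\<close>-th component of the
  time sequence as the truncated Toeplitz matrix of \<open>h i\<close>. Coefficients of \<open>coords x i\<close> beyond
  \<open>Nc\<close> are junk; power series multiplication never lets them influence earlier ones.\<close>

definition acts :: "nat \<Rightarrow> complex mat \<Rightarrow> (nat \<Rightarrow> complex fps) \<Rightarrow> bool" where
  "acts Nc M h \<longleftrightarrow> M \<in> carrier_mat (Nc * Nx) (Nc * Nx)
     \<and> (\<forall>x\<in>carrier_vec (Nc * Nx). \<forall>i<Nx. \<forall>j<Nc.
          fps_nth (coords (M *\<^sub>v x) i) j = fps_nth (h i * coords x i) j)"

lemma inv_U: "mat_inv U \<in> carrier_mat Nx Nx" "U * mat_inv U = 1\<^sub>m Nx" "mat_inv U * U = 1\<^sub>m Nx"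
proof -
  obtain B where "B \<in> carrier_mat Nx Nx" "U * B = 1\<^sub>m Nx" "B * U = 1\<^sub>m Nx"
    using invertible_matE[OF U_invertible U_carrier] .
  from mat_inv_works[OF U_carrier this] 
  show "mat_inv U \<in> carrier_mat Nx Nx" "U * mat_inv U = 1\<^sub>m Nx" "mat_inv U * U = 1\<^sub>m Nx" by auto
qed

lemma diagonalizes_eigenvectors:
  assumes D: "D \<in> carrier_mat Nx Nx" and ev: "\<And>i. i < Nx \<Longrightarrow> eigenvector D (col U i) (d i)"
  shows "diagonalizes D d"
  unfolding diagonalizes_def
proof (intro conjI ballI allI impI D)
  fix v :: "complex vec" and i assume v: "v \<in> carrier_vec Nx" and i: "i < Nx"
  let ?V = "mat_inv U"
  define w where "w = ?V *\<^sub>v v"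
  have w: "w \<in> carrier_vec Nx" using inv_U v by (simp add: w_def)
  have entry: "(?V * (D * U)) $$ (i, j) = (if i = j then d i else 0)" if j: "j < Nx" for j
  proof -
    have "col (D * U) j = D *\<^sub>v col U j" by (rule col_mult2[OF D U_carrier j])
    also have "\<dots> = d j \<cdot>\<^sub>v col U j" using ev[OF j] by (simp add: eigenvector_def)
    finally have "col (D * U) j = d j \<cdot>\<^sub>v col U j" .
    then have "(?V * (D * U)) $$ (i, j) = d j * (row ?V i \<bullet> col U j)"
      using inv_U D U_carrier i j by simp
    also have "row ?V i \<bullet> col U j = (?V * U) $$ (i, j)"
      using inv_U(1) U_carrier i j by simp
    finally show ?thesis using i j by (simp add: inv_U(3))
  qed
  \<comment> \<open>Inserting \<open>U\<close> times its inverse exposes the conjugated matrix,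
    whose entries were computed above.\<close>
  have "v = (U * ?V) *\<^sub>v v" using v by (simp add: inv_U(2))
  also have "\<dots> = U *\<^sub>v w" unfolding w_def using inv_U U_carrier v by (intro assoc_mult_mat_vec) auto
  finally have "?V *\<^sub>v (D *\<^sub>v v) = ?V *\<^sub>v (D *\<^sub>v (U *\<^sub>v w))" by simp
  also have "\<dots> = (?V * (D * U)) *\<^sub>v w"
    using inv_U(1) D U_carrier w by (simp add: assoc_mult_mat_vec[of _ Nx Nx _ Nx])
  also have "\<dots> $ i = (\<Sum>j<Nx. (?V * (D * U)) $$ (i, j) * w $ j)"
    using inv_U(1) D U_carrier w i
    by (subst index_mult_mat_vec) (auto simp: scalar_prod_def atLeast0LessThan intro!: sum.cong)
  also have "\<dots> = (\<Sum>j<Nx. if j = i then d i * w $ i else 0)"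
    by (intro sum.cong) (auto simp: entry)
  also have "\<dots> = d i * w $ i" using i by simp
  finally show "(?V *\<^sub>v (D *\<^sub>v v)) $ i = d i * (?V *\<^sub>v v) $ i" by (simp add: w_def)
qed

lemma diagonalizes_one: "diagonalizes (1\<^sub>m Nx) (\<lambda>_. 1)"
  by (simp add: diagonalizes_def)

lemma diagonalizes_zero: "diagonalizes (0\<^sub>m Nx Nx) (\<lambda>_. 0)"
proof -
  have "mat_inv U *\<^sub>v 0\<^sub>v Nx = 0\<^sub>v Nx" using inv_U(1) by (auto simp: vec_eq_iff)
  moreover have "0\<^sub>m Nx Nx *\<^sub>v v = 0\<^sub>v Nx" if "v \<in> carrier_vec Nx" for v :: "complex vec"
    using that by (auto simp: vec_eq_iff)
  ultimately show ?thesis by (simp add: diagonalizes_def)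
qed

lemma diagonalizes_uminus:
  assumes "diagonalizes D d"
  shows "diagonalizes (- D) (\<lambda>i. - d i)"
  unfolding diagonalizes_def
proof (intro conjI ballI allI impI)
  have D: "D \<in> carrier_mat Nx Nx" using assms by (simp add: diagonalizes_def)
  then show "- D \<in> carrier_mat Nx Nx" by simp
  fix v :: "complex vec" and i assume v: "v \<in> carrier_vec Nx" "i < Nx"
  have "- D *\<^sub>v v = - (D *\<^sub>v v)" using D v by simp
  moreover have "mat_inv U *\<^sub>v (- (D *\<^sub>v v)) = - (mat_inv U *\<^sub>v (D *\<^sub>v v))"
    using D v inv_U(1) by (auto simp: vec_eq_iff scalar_prod_def sum_negf)
  ultimately show "(mat_inv U *\<^sub>v (- D *\<^sub>v v)) $ i = - d i * (mat_inv U *\<^sub>v v) $ i"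
    using assms v inv_U(1) D by (simp add: diagonalizes_def)
qed

lemma diagonalizes_mult:
  assumes "diagonalizes D d" "diagonalizes E e"
  shows "diagonalizes (D * E) (\<lambda>i. d i * e i)"
proof -
  have "(D * E) *\<^sub>v v = D *\<^sub>v (E *\<^sub>v v)" if "v \<in> carrier_vec Nx" for v :: "complex vec"
    using assms that by (intro assoc_mult_mat_vec) (auto simp: diagonalizes_def)
  moreover have "E *\<^sub>v v \<in> carrier_vec Nx" if "v \<in> carrier_vec Nx" for v
    using assms that by (auto simp: diagonalizes_def)
  ultimately show ?thesis using assms by (auto simp: diagonalizes_def mult.assoc)
qed

lemma diagonalizes_pow:
  assumes "diagonalizes D d"
  shows "diagonalizes (D ^\<^sub>m k) (\<lambda>i. d i ^ k)"
proof (induction k)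
  case 0
  have "dim_row D = Nx" using assms by (auto simp: diagonalizes_def)
  then show ?case using diagonalizes_one by simp
next
  case (Suc k)
  from diagonalizes_mult[OF this assms] show ?case by (simp add: mult.commute)
qed

lemma acts_cong: "acts Nc M h \<Longrightarrow> (\<And>i. i < Nx \<Longrightarrow> h i = h' i) \<Longrightarrow> acts Nc M h'"
  by (simp add: acts_def)

lemma acts_one: "acts Nc (1\<^sub>m (Nc * Nx)) (\<lambda>_. 1)"
  by (simp add: acts_def)

text \<open>Causality of multiplication: this lets series known only below Nc be composed.\<close>

lemma fps_mult_nth_cong:
  "(\<And>l. l \<le> j \<Longrightarrow> fps_nth f l = fps_nth g l) \<Longrightarrow> fps_nth (h * f) j = fps_nth (h * g) j"
  by (simp add: fps_mult_nth)

lemma acts_mult: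
  assumes "acts Nc M h" "acts Nc M' h'"
  shows "acts Nc (M * M') (\<lambda>i. h i * h' i)"
  unfolding acts_def
proof (intro conjI ballI allI impI)
  have M: "M \<in> carrier_mat (Nc * Nx) (Nc * Nx)" "M' \<in> carrier_mat (Nc * Nx) (Nc * Nx)"
    using assms by (auto simp: acts_def)
  then show "M * M' \<in> carrier_mat (Nc * Nx) (Nc * Nx)" by simp
  fix x :: "complex vec" and i j assume x: "x \<in> carrier_vec (Nc * Nx)" and ij: "i < Nx" "j < Nc"
  have M'x: "M' *\<^sub>v x \<in> carrier_vec (Nc * Nx)" using M x by simp
  have "(M * M') *\<^sub>v x = M *\<^sub>v (M' *\<^sub>v x)" using M x by (intro assoc_mult_mat_vec)
  then have "fps_nth (coords ((M * M') *\<^sub>v x) i) j = fps_nth (h i * coords (M' *\<^sub>v x) i) j"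
    using assms(1) M'x ij by (simp add: acts_def)
  also have "\<dots> = fps_nth (h i * (h' i * coords x i)) j"
    using assms(2) x ij by (intro fps_mult_nth_cong) (simp add: acts_def)
  finally show "fps_nth (coords ((M * M') *\<^sub>v x) i) j = fps_nth (h i * h' i * coords x i) j"
    by (simp add: mult.assoc)
qed

lemma acts_pow:
  assumes "acts Nc M h"
  shows "acts Nc (M ^\<^sub>m p) (\<lambda>i. h i ^ p)"
proof (induction p)
  case 0
  have "dim_row M = Nc * Nx" using assms by (auto simp: acts_def)
  then show ?case using acts_one by simp
next
  case (Suc p)
  from acts_mult[OF this assms] show ?case by (simp add: mult.commute)
qed

lemma acts_minus:
  assumes "acts Nc M h" "acts Nc M' h'"
  shows "acts Nc (M - M') (\<lambda>i. h i - h' i)"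
  unfolding acts_def
proof (intro conjI ballI allI impI)
  have M: "M \<in> carrier_mat (Nc * Nx) (Nc * Nx)" "M' \<in> carrier_mat (Nc * Nx) (Nc * Nx)"
    using assms by (auto simp: acts_def)
  then show "M - M' \<in> carrier_mat (Nc * Nx) (Nc * Nx)" by (intro minus_carrier_mat)
  fix x :: "complex vec" and i j assume x: "x \<in> carrier_vec (Nc * Nx)" and ij: "i < Nx" "j < Nc"
  have "(M - M') *\<^sub>v x = M *\<^sub>v x - M' *\<^sub>v x" using M x by (rule minus_mult_distrib_mat_vec)
  moreover have "block Nx (y - z) j = block Nx y j - block Nx z j"
    if "y \<in> carrier_vec (Nc * Nx)" "z \<in> carrier_vec (Nc * Nx)" for y z
    using that ij by (auto simp: block_def vec_eq_iff block_index_less)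
  ultimately have "block Nx ((M - M') *\<^sub>v x) j = block Nx (M *\<^sub>v x) j - block Nx (M' *\<^sub>v x) j"
    using M x by simp
  then have "fps_nth (coords ((M - M') *\<^sub>v x) i) j
      = fps_nth (coords (M *\<^sub>v x) i) j - fps_nth (coords (M' *\<^sub>v x) i) j"
    unfolding coords_def fps_nth_Abs_fps
    using mult_minus_distrib_mat_vec[OF inv_U(1), of "block Nx (M *\<^sub>v x) j" "block Nx (M' *\<^sub>v x) j"]
      inv_U(1) ij by simp
  then show "fps_nth (coords ((M - M') *\<^sub>v x) i) j = fps_nth ((h i - h' i) * coords x i) j"
    using assms x ij by (simp add: acts_def left_diff_distrib)
qed

text \<open>Applying M to M' x returns x, so dividing by h i recovers the coordinates of M' x. The
  inverse of the block matrix is never computed.\<close>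

lemma acts_right_inverse:
  assumes M: "acts Nc M h" and M': "M' \<in> carrier_mat (Nc * Nx) (Nc * Nx)" "M * M' = 1\<^sub>m (Nc * Nx)"
    and h: "\<And>i. i < Nx \<Longrightarrow> fps_nth (h i) 0 \<noteq> 0"
  shows "acts Nc M' (\<lambda>i. inverse (h i))"
  unfolding acts_def
proof (intro conjI ballI allI impI M')
  fix x :: "complex vec" and i j assume x: "x \<in> carrier_vec (Nc * Nx)" and ij: "i < Nx" "j < Nc"
  have M'x: "M' *\<^sub>v x \<in> carrier_vec (Nc * Nx)" using M' x by simp
  have "M *\<^sub>v (M' *\<^sub>v x) = (M * M') *\<^sub>v x"
    using M M' x by (intro assoc_mult_mat_vec[symmetric]) (auto simp: acts_def)
  then have Mx: "M *\<^sub>v (M' *\<^sub>v x) = x" using M' x by simp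
  have "fps_nth (inverse (h i) * coords x i) j
      = fps_nth (inverse (h i) * (h i * coords (M' *\<^sub>v x) i)) j"
  proof (rule fps_mult_nth_cong)
    fix l assume "l \<le> j"
    then show "fps_nth (coords x i) l = fps_nth (h i * coords (M' *\<^sub>v x) i) l"
      using M M'x ij Mx unfolding acts_def by (metis le_less_trans)
  qed
  also have "\<dots> = fps_nth (coords (M' *\<^sub>v x) i) j"
    using inverse_mult_eq_1[OF h[OF ij(1)]] by (simp flip: mult.assoc)
  finally show "fps_nth (coords (M' *\<^sub>v x) i) j = fps_nth (inverse (h i) * coords x i) j" by simp
qed

lemma acts_block_bidiag:
  assumes "diagonalizes D d" "diagonalizes S s"
  shows "acts Nc (block_bidiag Nx Nc D S) (\<lambda>i. fps_const (d i) + fps_const (s i) * fps_X)"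
  unfolding acts_def
proof (intro conjI ballI allI impI)
  have DS: "D \<in> carrier_mat Nx Nx" "S \<in> carrier_mat Nx Nx"
    using assms by (auto simp: diagonalizes_def)
  let ?V = "mat_inv U"
  fix x :: "complex vec" and i j assume x: "x \<in> carrier_vec (Nc * Nx)" and ij: "i < Nx" "j < Nc"
  have zero: "?V *\<^sub>v 0\<^sub>v Nx = 0\<^sub>v Nx" using inv_U(1) by (auto simp: vec_eq_iff)
  have "fps_nth (coords (block_bidiag Nx Nc D S *\<^sub>v x) i) j
      = (?V *\<^sub>v (D *\<^sub>v block Nx x j) + ?V *\<^sub>v (if j = 0 then 0\<^sub>v Nx else S *\<^sub>v block Nx x (j - 1))) $ i"
    unfolding coords_def fps_nth_Abs_fps block_bidiag_mult_vec[OF DS x ij(2)]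
    using DS by (subst mult_add_distrib_mat_vec[OF inv_U(1)]) auto
  also have "\<dots> = (?V *\<^sub>v (D *\<^sub>v block Nx x j)) $ i
      + (if j = 0 then 0 else (?V *\<^sub>v (S *\<^sub>v block Nx x (j - 1))) $ i)"
    using inv_U(1) ij by (auto simp: zero)
  also have "\<dots> = d i * (?V *\<^sub>v block Nx x j) $ i
      + (if j = 0 then 0 else s i * (?V *\<^sub>v block Nx x (j - 1)) $ i)"
    using assms ij by (simp add: diagonalizes_def)
  also have "\<dots> = fps_nth ((fps_const (d i) + fps_const (s i) * fps_X) * coords x i) j"
    by (simp add: coords_def distrib_right mult.assoc)
  finally show "fps_nth (coords (block_bidiag Nx Nc D S *\<^sub>v x) i) j = \<dots>" .
qed simp

text \<open>Exchanging the sums over time and components splits the norm orthogonally into scalar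
  time sequences.\<close>

lemma U_vec_norm_coords: "U_vec_norm Nx Nc U x = sqrt (\<Sum>i<Nx. energy Nc (coords x i))"
proof -
  have "(l2_norm (mat_inv U *\<^sub>v block Nx x j))\<^sup>2 = (\<Sum>i<Nx. (cmod (fps_nth (coords x i) j))\<^sup>2)" for j
    using inv_U(1) by (simp add: l2_norm_def coords_def sum_nonneg)
  then show ?thesis unfolding U_vec_norm_def energy_def by (simp add: sum.swap[of _ "{..<Nx}"])
qed

text \<open>Lifts scalar test series to a block vector by applying \<open>U\<close> in each time
  block.\<close>

lemma coords_surj:
  obtains x where "x \<in> carrier_vec (Nc * Nx)"
    "\<And>i j. i < Nx \<Longrightarrow> j < Nc \<Longrightarrow> fps_nth (coords x i) j = fps_nth (z i) j"
proof -
  define w where "w j = vec Nx (\<lambda>i. fps_nth (z i) j)" for j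
  define x where "x = vec (Nc * Nx) (\<lambda>a. (U *\<^sub>v w (a div Nx)) $ (a mod Nx))"
  have w: "w j \<in> carrier_vec Nx" for j by (simp add: w_def)
  show ?thesis
  proof (rule that)
    show "x \<in> carrier_vec (Nc * Nx)" by (simp add: x_def)
    fix i j assume ij: "i < Nx" "j < Nc"
    have "block Nx x j = U *\<^sub>v w j"
    proof (rule eq_vecI)
      fix l assume "l < dim_vec (U *\<^sub>v w j)"
      then have "l < Nx" using U_carrier by simp
      then show "block Nx x j $ l = (U *\<^sub>v w j) $ l"
        using block_index_less[OF ij(2)] by (simp add: block_def x_def)
    qed (use U_carrier in \<open>simp add: block_def\<close>)
    then have "mat_inv U *\<^sub>v block Nx x j = (mat_inv U * U) *\<^sub>v w j"
      using assoc_mult_mat_vec[OF inv_U(1) U_carrier w] by simp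
    then show "fps_nth (coords x i) j = fps_nth (z i) j"
      using w ij by (simp add: coords_def inv_U(3)) (simp add: w_def)
  qed
qed

text \<open>A direct sum has the largest norm of its summands: componentwise estimates give the
  upper bound, vectors supported in one component the lower.\<close>

lemma U_norm_acts:
  assumes M: "acts Nc M h" and Nc: "Nc > 0"
  shows "U_norm Nx Nc U M = (SUP i\<in>{..<Nx}. trunc_norm Nc (h i))"
proof (rule antisym)
  let ?S = "{U_vec_norm Nx Nc U (M *\<^sub>v v) / U_vec_norm Nx Nc U v | v.
    v \<in> carrier_vec (Nc * Nx) \<and> v \<noteq> 0\<^sub>v (Nc * Nx)}"
  define c where "c = (SUP i\<in>{..<Nx}. trunc_norm Nc (h i))"
  have M_dim: "dim_col M = Nc * Nx" using M by (auto simp: acts_def)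
  have c: "trunc_norm Nc (h i) \<le> c" if "i < Nx" for i
    unfolding c_def using that by (intro cSUP_upper) auto
  have c0: "c \<ge> 0" using c[OF Nx_pos] trunc_norm_nonneg[OF Nc] order_trans by blast
  have coords_M: "energy Nc (coords (M *\<^sub>v v) i) = energy Nc (h i * coords v i)"
    if "v \<in> carrier_vec (Nc * Nx)" "i < Nx" for v i
    using M that by (intro energy_cong) (simp add: acts_def)
  have le: "t \<le> c" if t_in: "t \<in> ?S" for t
  proof -
    obtain v where v: "v \<in> carrier_vec (Nc * Nx)"
      and t: "t = U_vec_norm Nx Nc U (M *\<^sub>v v) / U_vec_norm Nx Nc U v"
      using t_in by blast
    have "(\<Sum>i<Nx. energy Nc (coords (M *\<^sub>v v) i)) \<le> (\<Sum>i<Nx. c\<^sup>2 * energy Nc (coords v i))"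
    proof (rule sum_mono)
      fix i assume i: "i \<in> {..<Nx}"
      have "energy Nc (coords (M *\<^sub>v v) i) \<le> (trunc_norm Nc (h i))\<^sup>2 * energy Nc (coords v i)"
        using coords_M[OF v, of i] i energy_mult_le_trunc_norm by simp
      also have "\<dots> \<le> c\<^sup>2 * energy Nc (coords v i)"
        using c[of i] i trunc_norm_nonneg[OF Nc, of "h i"] by (intro mult_right_mono power_mono) auto
      finally show "energy Nc (coords (M *\<^sub>v v) i) \<le> c\<^sup>2 * energy Nc (coords v i)" .
    qed
    then have "(\<Sum>i<Nx. energy Nc (coords (M *\<^sub>v v) i)) \<le> c\<^sup>2 * (\<Sum>i<Nx. energy Nc (coords v i))"
      by (simp only: sum_distrib_left)
    from real_sqrt_le_mono[OF this] have "U_vec_norm Nx Nc U (M *\<^sub>v v) \<le> c * U_vec_norm Nx Nc U v"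
      unfolding U_vec_norm_coords using c0 by (simp add: real_sqrt_mult)
    moreover have "U_vec_norm Nx Nc U v \<ge> 0" unfolding U_vec_norm_coords by (simp add: sum_nonneg)
    \<comment> \<open>If the denominator is zero, the quotient is 0 by convention.\<close>
    ultimately show ?thesis using c0 unfolding t
      by (cases "U_vec_norm Nx Nc U v = 0") (auto simp: pos_divide_le_eq)
  qed
  have attained: "sqrt (energy Nc (h i * g) / energy Nc g) \<in> ?S" if i: "i < Nx" and g: "energy Nc g > 0" for i g
  proof -
    obtain v where v: "v \<in> carrier_vec (Nc * Nx)"
      and vc: "\<And>l j. l < Nx \<Longrightarrow> j < Nc \<Longrightarrow> fps_nth (coords v l) j = fps_nth (if l = i then g else 0) j"
      using coords_surj[of Nc "\<lambda>l. if l = i then g else 0"] by blast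
    have "energy Nc (f * coords v l) = (if l = i then energy Nc (f * g) else 0)" if "l < Nx" for f l
    proof -
      have "energy Nc (f * coords v l) = energy Nc (f * (if l = i then g else 0))"
        using vc[OF that] by (intro energy_cong fps_mult_nth_cong) auto
      then show ?thesis by (simp add: energy_def)
    qed
    note e = this this[of _ 1, simplified]
    have "U_vec_norm Nx Nc U v = sqrt (energy Nc g)"
      unfolding U_vec_norm_coords using i by (simp add: e)
    moreover have "U_vec_norm Nx Nc U (M *\<^sub>v v) = sqrt (energy Nc (h i * g))"
      unfolding U_vec_norm_coords using i by (simp add: coords_M[OF v] e)
    moreover have "v \<noteq> 0\<^sub>v (Nc * Nx)"
    proof
      assume v0: "v = 0\<^sub>v (Nc * Nx)"
      have "fps_nth g j = 0" if "j < Nc" for j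
      proof -
        have "block Nx v j = 0\<^sub>v Nx"
          unfolding v0 using that by (auto simp: block_def vec_eq_iff block_index_less)
        moreover have "(mat_inv U *\<^sub>v 0\<^sub>v Nx) $ i = 0" using inv_U(1) i by simp
        ultimately show ?thesis using vc[OF i that] by (simp add: coords_def)
      qed
      then have "energy Nc g = 0" by (simp add: energy_def)
      with g show False by simp
    qed
    ultimately show ?thesis using v by (auto simp: real_sqrt_divide)
  qed
  show "U_norm Nx Nc U M \<le> (SUP i\<in>{..<Nx}. trunc_norm Nc (h i))"
    unfolding U_norm_def induced_norm_def c_def[symmetric] M_dim
  proof (rule cSup_least)
    show "?S \<noteq> {}" using attained[OF Nx_pos energy_one_pos[OF Nc]] by blast
  qed (rule le)
  show "(SUP i\<in>{..<Nx}. trunc_norm Nc (h i)) \<le> U_norm Nx Nc U M"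
  proof (rule cSUP_least)
    fix i assume "i \<in> {..<Nx}"
    then show "trunc_norm Nc (h i) \<le> U_norm Nx Nc U M"
      unfolding trunc_norm_def U_norm_def induced_norm_def M_dim
      using energy_one_pos[OF Nc] attained le
      by (intro cSUP_least cSup_upper bdd_aboveI[of _ c]) auto
  qed (use Nx_pos in auto)
qed


section \<open>Symbols of the two operators and of their powers\<close>

text \<open>On symbols 1 - A / B = (B - A) / B, and B - A is the single term (lam^k - mu) X.\<close>

lemma acts_F_op:
  assumes "diagonalizes \<Phi> lam" "diagonalizes \<Psi> mu"
  shows "acts Nc (F_op Nx Nc k \<Phi> \<Psi>) (\<lambda>i. fps_const (lam i ^ k - mu i) * kernel 1 1 (mu i))"
proof -
  let ?A = "A_Delta Nx Nc k \<Phi>" and ?B = "B_Delta Nx Nc \<Psi>"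
  have A: "acts Nc ?A (\<lambda>i. bidiag (lam i ^ k))"
    unfolding A_Delta_def
    using acts_block_bidiag[OF diagonalizes_one diagonalizes_uminus[OF diagonalizes_pow[OF assms(1)]]]
    by (rule acts_cong) (simp flip: fps_const_neg)
  have B: "acts Nc ?B (\<lambda>i. bidiag (mu i))"
    unfolding B_Delta_def
    using acts_block_bidiag[OF diagonalizes_one diagonalizes_uminus[OF assms(2)]]
    by (rule acts_cong) (simp flip: fps_const_neg)
  have "acts Nc (mat_inv ?B) (\<lambda>i. inverse (bidiag (mu i)))"
    using B by (rule acts_right_inverse) (auto simp: B_Delta_def block_bidiag_one_inverse)
  from acts_minus[OF acts_one acts_mult[OF A this]] show ?thesis
    unfolding F_op_def
  proof (rule acts_cong)
    fix i
    have "bidiag (mu i) * inverse (bidiag (mu i)) = 1" by (rule inverse_mult_eq_1') simp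
    then have "1 - bidiag (lam i ^ k) * inverse (bidiag (mu i))
        = (bidiag (mu i) - bidiag (lam i ^ k)) * inverse (bidiag (mu i))"
      by (metis left_diff_distrib)
    also have "bidiag (mu i) - bidiag (lam i ^ k) = fps_const (lam i ^ k - mu i) * fps_X"
      by (simp add: algebra_simps flip: fps_const_sub)
    finally show "1 - bidiag (lam i ^ k) * inverse (bidiag (mu i))
        = fps_const (lam i ^ k - mu i) * kernel 1 1 (mu i)"
      by (simp add: kernel_def mult.assoc)
  qed
qed

text \<open>The additional factor has symbol lam^k X, which raises the shift to m = 2.\<close>

lemma acts_FCF_op:
  assumes "diagonalizes \<Phi> lam" "diagonalizes \<Psi> mu"
  shows "acts Nc (FCF_op Nx Nc k \<Phi> \<Psi>)
    (\<lambda>i. fps_const (lam i ^ k * (lam i ^ k - mu i)) * kernel 2 1 (mu i))"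
  unfolding FCF_op_def A_cf_ff_fc_def
  using acts_mult[OF acts_F_op[OF assms]
      acts_block_bidiag[OF diagonalizes_zero diagonalizes_pow[OF assms(1)]]]
  by (rule acts_cong) (simp add: kernel_def power2_eq_square mult_ac flip: fps_const_mult)

lemma U_norm_acts_kernel:
  assumes "acts Nc M (\<lambda>i. fps_const (c i) * kernel m p (mu i))" "Nc > 0"
  shows "U_norm Nx Nc U M = (SUP i\<in>{..<Nx}. cmod (c i) * trunc_norm Nc (kernel m p (mu i)))"
  unfolding U_norm_acts[OF assms] trunc_norm_const_mult[OF assms(2)] ..

text \<open>The scalar gap lemma gives one sequence for each eigenvalue, valid for all large Nc at
  once. The condition Nc > m p excludes the sizes for which the factor X^(m p) makes the power
  zero.\<close>

lemma U_norm_power_gap: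
  assumes acts: "\<And>Nc. acts Nc (M Nc) (\<lambda>i. fps_const (c i) * kernel m 1 (mu i))"
    and mu: "\<And>i. i < Nx \<Longrightarrow> 0 < cmod (mu i) \<and> cmod (mu i) < 1" and "m > 0" "p > 0"
  shows "\<exists>\<epsilon> :: nat \<Rightarrow> nat \<Rightarrow> real.
      (\<forall>i<Nx. (\<forall>Nc. \<epsilon> i Nc > 0) \<and> \<epsilon> i \<in> \<Theta>(\<lambda>Nc. 1 / (real Nc)\<^sup>2))
    \<and> (\<forall>Nc>m * p. U_norm Nx Nc U (M Nc ^\<^sub>m p)
        = (SUP i\<in>{..<Nx}. cmod (c i) ^ p / sqrt ((1 - cmod (mu i)) ^ (2 * p) + \<epsilon> i Nc)))"
proof -
  have "\<exists>e :: nat \<Rightarrow> real. (\<forall>Nc. e Nc > 0) \<and> e \<in> \<Theta>(\<lambda>Nc. 1 / (real Nc)\<^sup>2)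
      \<and> (\<forall>Nc>m * p. trunc_norm Nc (kernel (m * p) p (mu i))
            = 1 / sqrt ((1 - cmod (mu i)) ^ (2 * p) + e Nc))" if "i < Nx" for i
    using trunc_norm_kernel_gap[of "mu i" "m * p" p] mu[OF that] assms(3,4) by (metis nat_0_less_mult_iff)
  then obtain \<epsilon> :: "nat \<Rightarrow> nat \<Rightarrow> real" where \<epsilon>: "\<And>i. i < Nx \<Longrightarrow> (\<forall>Nc. \<epsilon> i Nc > 0)
      \<and> \<epsilon> i \<in> \<Theta>(\<lambda>Nc. 1 / (real Nc)\<^sup>2) \<and> (\<forall>Nc>m * p. trunc_norm Nc (kernel (m * p) p (mu i))
            = 1 / sqrt ((1 - cmod (mu i)) ^ (2 * p) + \<epsilon> i Nc))"
    by metis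
  have "U_norm Nx Nc U (M Nc ^\<^sub>m p)
      = (SUP i\<in>{..<Nx}. cmod (c i) ^ p / sqrt ((1 - cmod (mu i)) ^ (2 * p) + \<epsilon> i Nc))"
    if Nc: "Nc > m * p" for Nc
  proof -
    have "acts Nc (M Nc ^\<^sub>m p) (\<lambda>i. fps_const (c i ^ p) * kernel (m * p) p (mu i))"
      using acts_pow[OF acts] by (rule acts_cong) (simp add: power_mult_distrib kernel_power fps_const_power)
    then have "U_norm Nx Nc U (M Nc ^\<^sub>m p)
        = (SUP i\<in>{..<Nx}. cmod (c i ^ p) * trunc_norm Nc (kernel (m * p) p (mu i)))"
      using Nc by (intro U_norm_acts_kernel) auto
    also have "\<dots> = (SUP i\<in>{..<Nx}. cmod (c i) ^ p / sqrt ((1 - cmod (mu i)) ^ (2 * p) + \<epsilon> i Nc))"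
      using \<epsilon> Nc by (intro SUP_cong refl) (simp add: norm_power)
    finally show ?thesis .
  qed
  with \<epsilon> show ?thesis by (intro exI[of _ \<epsilon>]) blast
qed

end

text \<open>With FCF-relaxation only Nc - 2 samples are visible, so the lower bound over all
  eigenvalues carries pi / (Nc - 1). The form with pi / Nc is asserted for each eigenvalue that
  meets the cosine condition.\<close>

theorem theorem5p2:
  fixes \<Phi> \<Psi> U :: "complex mat" and lam mu :: "nat \<Rightarrow> complex" and Nx k :: nat
  assumes "Nx \<ge> 1" and "k \<ge> 1"
    and "\<Phi> \<in> carrier_mat Nx Nx" and "\<Psi> \<in> carrier_mat Nx Nx" and "U \<in> carrier_mat Nx Nx"
    and "invertible_mat \<Phi>" and "invertible_mat \<Psi>"
    and "\<exists>q. induced_norm l2_norm (\<Phi> ^\<^sub>m q) < 1 \<and> induced_norm l2_norm (\<Psi> ^\<^sub>m q) < 1"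
    and "\<Phi> * \<Psi> = \<Psi> * \<Phi>"
    and "invertible_mat U"
    and "\<And>i. i < Nx \<Longrightarrow> eigenvector \<Phi> (col U i) (lam i)"
    and "\<And>i. i < Nx \<Longrightarrow> eigenvector \<Psi> (col U i) (mu i)"
  shows
    "(\<forall>Nc\<ge>2.
        (SUP i\<in>{..<Nx}. cmod (mu i - lam i ^ k)
            / sqrt ((1 - cmod (mu i))\<^sup>2 + pi\<^sup>2 * cmod (mu i) / (real Nc)\<^sup>2))
          \<le> U_norm Nx Nc U (F_op Nx Nc k \<Phi> \<Psi>)
      \<and> U_norm Nx Nc U (F_op Nx Nc k \<Phi> \<Psi>)
          \<le> (SUP i\<in>{..<Nx}. cmod (mu i - lam i ^ k)
            / sqrt ((1 - cmod (mu i))\<^sup>2 + pi\<^sup>2 * cmod (mu i) / (6 * (real Nc)\<^sup>2)))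
      \<and> (\<forall>i<Nx. 2 * cmod (mu i) * cos (pi / real Nc) \<ge> 1 \<longrightarrow>
          cmod (lam i ^ k) * cmod (mu i - lam i ^ k)
            / sqrt ((1 - cmod (mu i))\<^sup>2 + pi\<^sup>2 * cmod (mu i) / (real Nc)\<^sup>2)
          \<le> U_norm Nx Nc U (FCF_op Nx Nc k \<Phi> \<Psi>))
      \<and> (Nc \<ge> 3 \<longrightarrow>
          (SUP i\<in>{..<Nx}. cmod (lam i ^ k) * cmod (mu i - lam i ^ k)
            / sqrt ((1 - cmod (mu i))\<^sup>2 + pi\<^sup>2 * cmod (mu i) / (real Nc - 1)\<^sup>2))
          \<le> U_norm Nx Nc U (FCF_op Nx Nc k \<Phi> \<Psi>))
      \<and> U_norm Nx Nc U (FCF_op Nx Nc k \<Phi> \<Psi>)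
          \<le> (SUP i\<in>{..<Nx}. cmod (lam i ^ k) * cmod (mu i - lam i ^ k)
            / sqrt ((1 - cmod (mu i))\<^sup>2 + pi\<^sup>2 * cmod (mu i) / (6 * (real Nc)\<^sup>2))))
   \<and> (\<forall>p\<ge>1. \<exists>\<epsilon> :: nat \<Rightarrow> nat \<Rightarrow> real.
        (\<forall>i<Nx. (\<forall>Nc. \<epsilon> i Nc > 0) \<and> \<epsilon> i \<in> \<Theta>(\<lambda>Nc. 1 / (real Nc)\<^sup>2))
      \<and> (\<forall>Nc>p. U_norm Nx Nc U (F_op Nx Nc k \<Phi> \<Psi> ^\<^sub>m p)
          = (SUP i\<in>{..<Nx}. cmod (mu i - lam i ^ k) ^ p
            / sqrt ((1 - cmod (mu i)) ^ (2 * p) + \<epsilon> i Nc))))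
   \<and> (\<forall>p\<ge>1. \<exists>\<epsilon> :: nat \<Rightarrow> nat \<Rightarrow> real.
        (\<forall>i<Nx. (\<forall>Nc. \<epsilon> i Nc > 0) \<and> \<epsilon> i \<in> \<Theta>(\<lambda>Nc. 1 / (real Nc)\<^sup>2))
      \<and> (\<forall>Nc>2 * p. U_norm Nx Nc U (FCF_op Nx Nc k \<Phi> \<Psi> ^\<^sub>m p)
          = (SUP i\<in>{..<Nx}. cmod (lam i ^ k) ^ p * cmod (mu i - lam i ^ k) ^ p
            / sqrt ((1 - cmod (mu i)) ^ (2 * p) + \<epsilon> i Nc))))"
proof -
  interpret eigenbasis Nx U
    using assms by unfold_locales auto
  have \<Phi>: "diagonalizes \<Phi> lam" and \<Psi>: "diagonalizes \<Psi> mu"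
    using assms by (auto intro: diagonalizes_eigenvectors)
  have mu: "0 < cmod (mu i) \<and> cmod (mu i) < 1" if "i < Nx" for i
    using eigenvalue_norm_less_1[OF assms(4) assms(12)[OF that]]
      eigenvalue_nonzero[OF assms(4,7) assms(12)[OF that]] assms(8)
    by auto
  define a where "a i = lam i ^ k - mu i" for i
  have a: "cmod (mu i - lam i ^ k) = cmod (a i)" for i by (simp add: a_def norm_minus_commute)
  have F: "acts Nc (F_op Nx Nc k \<Phi> \<Psi>) (\<lambda>i. fps_const (a i) * kernel 1 1 (mu i))" for Nc
    unfolding a_def by (rule acts_F_op[OF \<Phi> \<Psi>])
  have FCF: "acts Nc (FCF_op Nx Nc k \<Phi> \<Psi>) (\<lambda>i. fps_const (lam i ^ k * a i) * kernel 2 1 (mu i))" for Nc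
    unfolding a_def by (rule acts_FCF_op[OF \<Phi> \<Psi>])
  \<comment> \<open>The length Nc - m + 1 is Nc for m = 1 and Nc - 1 for m = 2.\<close>
  have lower: "1 / sqrt ((1 - cmod (mu i))\<^sup>2 + pi\<^sup>2 * cmod (mu i) / (real (Nc - m) + 1)\<^sup>2)
      \<le> trunc_norm Nc (kernel m 1 (mu i))" if "i < Nx" "m < Nc" for i m Nc
    using trunc_norm_kernel_ge_sine[of "mu i" m Nc 1] mu[OF that(1)] that(2) by (simp add: mult.commute)
  have upper: "trunc_norm Nc (kernel m 1 (mu i))
      \<le> 1 / sqrt ((1 - cmod (mu i))\<^sup>2 + pi\<^sup>2 * cmod (mu i) / (6 * (real Nc)\<^sup>2))"
    if "i < Nx" "m > 0" "Nc > 0" for i m Nc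
    using trunc_norm_kernel_le[of "mu i" m Nc 1] mu[OF that(1)] that(2,3) by simp
  have scale: "s \<le> t \<Longrightarrow> c \<ge> 0 \<Longrightarrow> c * s \<le> c * t" for c s t :: real
    by (rule mult_left_mono)
  show ?thesis
  proof (intro conjI allI impI)
    fix Nc :: nat assume Nc: "2 \<le> Nc"
    have UF: "U_norm Nx Nc U (F_op Nx Nc k \<Phi> \<Psi>)
        = (SUP i\<in>{..<Nx}. cmod (a i) * trunc_norm Nc (kernel 1 1 (mu i)))"
      using Nc by (intro U_norm_acts_kernel F) auto
    have UFCF: "U_norm Nx Nc U (FCF_op Nx Nc k \<Phi> \<Psi>)
        = (SUP i\<in>{..<Nx}. cmod (lam i ^ k) * cmod (a i) * trunc_norm Nc (kernel 2 1 (mu i)))"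
      using Nc U_norm_acts_kernel[OF FCF, of Nc] by (simp add: norm_mult)
    show "(SUP i\<in>{..<Nx}. cmod (mu i - lam i ^ k)
            / sqrt ((1 - cmod (mu i))\<^sup>2 + pi\<^sup>2 * cmod (mu i) / (real Nc)\<^sup>2))
          \<le> U_norm Nx Nc U (F_op Nx Nc k \<Phi> \<Psi>)"
      unfolding UF
    proof (rule cSUP_finite_mono[OF Nx_pos])
      fix i assume "i < Nx"
      then show "cmod (mu i - lam i ^ k) / sqrt ((1 - cmod (mu i))\<^sup>2 + pi\<^sup>2 * cmod (mu i) / (real Nc)\<^sup>2)
          \<le> cmod (a i) * trunc_norm Nc (kernel 1 1 (mu i))"
        using scale[OF lower[of i 1 Nc], of "cmod (a i)"] Nc by (simp add: a of_nat_diff)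
    qed
    show "U_norm Nx Nc U (F_op Nx Nc k \<Phi> \<Psi>)
        \<le> (SUP i\<in>{..<Nx}. cmod (mu i - lam i ^ k)
            / sqrt ((1 - cmod (mu i))\<^sup>2 + pi\<^sup>2 * cmod (mu i) / (6 * (real Nc)\<^sup>2)))"
      unfolding UF
    proof (rule cSUP_finite_mono[OF Nx_pos])
      fix i assume "i < Nx"
      then show "cmod (a i) * trunc_norm Nc (kernel 1 1 (mu i)) \<le> cmod (mu i - lam i ^ k)
            / sqrt ((1 - cmod (mu i))\<^sup>2 + pi\<^sup>2 * cmod (mu i) / (6 * (real Nc)\<^sup>2))"
        using scale[OF upper[of i 1 Nc], of "cmod (a i)"] Nc by (simp add: a)
    qed
    show "U_norm Nx Nc U (FCF_op Nx Nc k \<Phi> \<Psi>)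
        \<le> (SUP i\<in>{..<Nx}. cmod (lam i ^ k) * cmod (mu i - lam i ^ k)
            / sqrt ((1 - cmod (mu i))\<^sup>2 + pi\<^sup>2 * cmod (mu i) / (6 * (real Nc)\<^sup>2)))"
      unfolding UFCF
    proof (rule cSUP_finite_mono[OF Nx_pos])
      fix i assume "i < Nx"
      then show "cmod (lam i ^ k) * cmod (a i) * trunc_norm Nc (kernel 2 1 (mu i))
          \<le> cmod (lam i ^ k) * cmod (mu i - lam i ^ k)
            / sqrt ((1 - cmod (mu i))\<^sup>2 + pi\<^sup>2 * cmod (mu i) / (6 * (real Nc)\<^sup>2))"
        using scale[OF upper[of i 2 Nc], of "cmod (lam i ^ k) * cmod (a i)"] Nc by (simp add: a)
    qed
    show "(SUP i\<in>{..<Nx}. cmod (lam i ^ k) * cmod (mu i - lam i ^ k)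
            / sqrt ((1 - cmod (mu i))\<^sup>2 + pi\<^sup>2 * cmod (mu i) / (real Nc - 1)\<^sup>2))
          \<le> U_norm Nx Nc U (FCF_op Nx Nc k \<Phi> \<Psi>)" if "3 \<le> Nc"
      unfolding UFCF
    proof (rule cSUP_finite_mono[OF Nx_pos])
      fix i assume "i < Nx"
      moreover have "real (Nc - 2) + 1 = real Nc - 1" using Nc by (simp add: of_nat_diff)
      ultimately show "cmod (lam i ^ k) * cmod (mu i - lam i ^ k)
            / sqrt ((1 - cmod (mu i))\<^sup>2 + pi\<^sup>2 * cmod (mu i) / (real Nc - 1)\<^sup>2)
          \<le> cmod (lam i ^ k) * cmod (a i) * trunc_norm Nc (kernel 2 1 (mu i))"
        using scale[OF lower[of i 2 Nc], of "cmod (lam i ^ k) * cmod (a i)"] that by (simp add: a)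
    qed
    fix i assume i: "i < Nx" and cos: "1 \<le> 2 * cmod (mu i) * cos (pi / real Nc)"
    have "cmod (lam i ^ k) * cmod (mu i - lam i ^ k)
            / sqrt ((1 - cmod (mu i))\<^sup>2 + pi\<^sup>2 * cmod (mu i) / (real Nc)\<^sup>2)
        \<le> cmod (lam i ^ k) * cmod (a i) * trunc_norm Nc (kernel 2 1 (mu i))"
      using scale[OF trunc_norm_kernel_ge_two[of "mu i" Nc], of "cmod (lam i ^ k) * cmod (a i)"]
        mu[OF i] Nc cos by (simp add: a)
    also have "\<dots> \<le> U_norm Nx Nc U (FCF_op Nx Nc k \<Phi> \<Psi>)"
      unfolding UFCF using i by (intro cSUP_upper) auto
    finally show "cmod (lam i ^ k) * cmod (mu i - lam i ^ k)
            / sqrt ((1 - cmod (mu i))\<^sup>2 + pi\<^sup>2 * cmod (mu i) / (real Nc)\<^sup>2)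
          \<le> U_norm Nx Nc U (FCF_op Nx Nc k \<Phi> \<Psi>)" .
  next
    fix p :: nat assume "1 \<le> p"
    then show "\<exists>\<epsilon> :: nat \<Rightarrow> nat \<Rightarrow> real.
        (\<forall>i<Nx. (\<forall>Nc. \<epsilon> i Nc > 0) \<and> \<epsilon> i \<in> \<Theta>(\<lambda>Nc. 1 / (real Nc)\<^sup>2))
      \<and> (\<forall>Nc>p. U_norm Nx Nc U (F_op Nx Nc k \<Phi> \<Psi> ^\<^sub>m p)
          = (SUP i\<in>{..<Nx}. cmod (mu i - lam i ^ k) ^ p
            / sqrt ((1 - cmod (mu i)) ^ (2 * p) + \<epsilon> i Nc)))"
      using U_norm_power_gap[OF F mu, where p = p] by (simp add: a)
    from \<open>1 \<le> p\<close> show "\<exists>\<epsilon> :: nat \<Rightarrow> nat \<Rightarrow> real.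
        (\<forall>i<Nx. (\<forall>Nc. \<epsilon> i Nc > 0) \<and> \<epsilon> i \<in> \<Theta>(\<lambda>Nc. 1 / (real Nc)\<^sup>2))
      \<and> (\<forall>Nc>2 * p. U_norm Nx Nc U (FCF_op Nx Nc k \<Phi> \<Psi> ^\<^sub>m p)
          = (SUP i\<in>{..<Nx}. cmod (lam i ^ k) ^ p * cmod (mu i - lam i ^ k) ^ p
            / sqrt ((1 - cmod (mu i)) ^ (2 * p) + \<epsilon> i Nc)))"
      using U_norm_power_gap[OF FCF mu, where p = p] by (simp add: a norm_mult power_mult_distrib)
  qed
qed

end
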